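(* Let $r\ge1$, $s\ge0$. The Heisenberg algebra $\mathcal H_{2r,s}$ is a quantum group, with coproduct $\Delta$, counit $\epsilon$ and antipode $S$ given on generators by $$\Delta(1)=1\otimes1,\qquad \Delta(\varepsilon)=\varepsilon\otimes1+1\otimes\varepsilon,\qquad \Delta(x)=x\otimes1+1\otimes x,$$ $$\epsilon(1)=1,\qquad \epsilon(\varepsilon)=0,\qquad \epsilon(x)=0,$$ $$S(1)=1,\qquad S(\varepsilon)=-\varepsilon,\qquad S(x)=-x,$$ for all $x\in\{p_1,\dots,p_r,q_1,\dots,q_r,y_1,\dots,y_s\}$.
   Context: $\mathcal H_{2r,s}$ is the unital associative complex algebra generated by $p_1,\dots,p_r,q_1,\dots,q_r,y_1,\dots,y_s,\varepsilon$, with $\varepsilon$ central, all commutators of generators zero except $[p_i,q_j]=i\varepsilon\delta_{ij}$. "Quantum group" means Hopf algebra over $\mathbb C$; $\Delta$ and $\epsilon$ are extended from generators as algebra homomorphisms, and $S$ as an algebra anti-homomorphism. *)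

theory Defs
  imports Complex_Main "HOL-Library.Poly_Mapping" "HOL-Algebra.Module" "HOL-Algebra.QuotRing"
begin

text \<open>The field of complex numbers, as the ring of scalars and as an algebra over itself.\<close>

definition complex_alg :: "(complex, complex) module" where
  "complex_alg =
    \<lparr>carrier = UNIV, mult = (*), one = 1, zero = 0, add = (+), smult = (*)\<rparr>"

text \<open>Associative unital algebras; the locale \<^locale>\<open>algebra\<close> of the library is restricted to
  commutative ones.\<close>

locale complex_algebra = module complex_alg A + ring A
  for A :: "(complex, 'a) module" (structure) +
  assumes smult_mult_left:
      "\<lbrakk>x \<in> carrier A; y \<in> carrier A\<rbrakk> \<Longrightarrow> (c \<odot> x) \<otimes> y = c \<odot> (x \<otimes> y)"
    and smult_mult_right:
      "\<lbrakk>x \<in> carrier A; y \<in> carrier A\<rbrakk> \<Longrightarrow> x \<otimes> (c \<odot> y) = c \<odot> (x \<otimes> y)"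

definition linear_maps ::
    "(complex, 'a) module \<Rightarrow> (complex, 'b) module \<Rightarrow> ('a \<Rightarrow> 'b) set" where
  "linear_maps A B = {f. f \<in> carrier A \<rightarrow> carrier B \<and>
     (\<forall>x\<in>carrier A. \<forall>y\<in>carrier A. f (x \<oplus>\<^bsub>A\<^esub> y) = f x \<oplus>\<^bsub>B\<^esub> f y) \<and>
     (\<forall>c. \<forall>x\<in>carrier A. f (c \<odot>\<^bsub>A\<^esub> x) = c \<odot>\<^bsub>B\<^esub> f x)}"

definition algebra_hom ::
    "(complex, 'a) module \<Rightarrow> (complex, 'b) module \<Rightarrow> ('a \<Rightarrow> 'b) set" where
  "algebra_hom A B = linear_maps A B \<inter> ring_hom A B"

definition algebra_antihom ::
    "(complex, 'a) module \<Rightarrow> (complex, 'b) module \<Rightarrow> ('a \<Rightarrow> 'b) set" where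
  "algebra_antihom A B = {f \<in> linear_maps A B. f \<one>\<^bsub>A\<^esub> = \<one>\<^bsub>B\<^esub> \<and>
     (\<forall>x\<in>carrier A. \<forall>y\<in>carrier A. f (x \<otimes>\<^bsub>A\<^esub> y) = f y \<otimes>\<^bsub>B\<^esub> f x)}"

text \<open>The monoid algebra: formal complex linear combinations of elements of a monoid. The
  multiplication of \<^type>\<open>poly_mapping\<close> is not used because it is tied to a type class of monoids.\<close>

definition monoid_algebra :: "('g, 'm) monoid_scheme \<Rightarrow> (complex, 'g \<Rightarrow>\<^sub>0 complex) module" where
  "monoid_algebra G =
    \<lparr>carrier = {f. Poly_Mapping.keys f \<subseteq> carrier G},
     mult = (\<lambda>f g. \<Sum>x\<in>Poly_Mapping.keys f. \<Sum>y\<in>Poly_Mapping.keys g.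
        Poly_Mapping.single (x \<otimes>\<^bsub>G\<^esub> y)
          (Poly_Mapping.lookup f x * Poly_Mapping.lookup g y)),
     one = Poly_Mapping.single \<one>\<^bsub>G\<^esub> 1,
     zero = 0,
     add = (+),
     smult = (\<lambda>c. Poly_Mapping.map ((*) c))\<rparr>"

definition free_algebra :: "'x set \<Rightarrow> (complex, 'x list \<Rightarrow>\<^sub>0 complex) module" where
  "free_algebra X = monoid_algebra \<lparr>carrier = lists X, mult = (@), one = []\<rparr>"

definition quotient_algebra ::
    "(complex, 'a) module \<Rightarrow> 'a set \<Rightarrow> (complex, 'a set) module" where
  "quotient_algebra A I =
    \<lparr>carrier = carrier (A Quot I), mult = mult (A Quot I), one = one (A Quot I),
     zero = zero (A Quot I), add = add (A Quot I),
     smult = (\<lambda>c X. \<Union>x\<in>X. I +>\<^bsub>A\<^esub> (c \<odot>\<^bsub>A\<^esub> x))\<rparr>"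

definition linear_span :: "(complex, 'a) module \<Rightarrow> 'a set \<Rightarrow> 'a set" where
  "linear_span A X = \<Inter>{N. submodule N complex_alg A \<and> X \<subseteq> N}"

text \<open>The tensor product of \<^term>\<open>A\<close> and \<^term>\<open>B\<close> is the vector space with basis
  \<^term>\<open>carrier A \<times> carrier B\<close> modulo the subspace spanned by the bilinearity relations. The
  multiplication of the monoid algebra of \<^term>\<open>A \<times>\<times> B\<close> induces on it the multiplication with
  \<open>(x \<otimes> y) (x' \<otimes> y') = x x' \<otimes> y y'\<close>.\<close>

definition bilinearity_relations ::
    "(complex, 'a) module \<Rightarrow> (complex, 'b) module \<Rightarrow> ('a \<times> 'b \<Rightarrow>\<^sub>0 complex) set" where
  "bilinearity_relations A B =
    {Poly_Mapping.single (x \<oplus>\<^bsub>A\<^esub> x', y) 1 - Poly_Mapping.single (x, y) 1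
       - Poly_Mapping.single (x', y) 1 |
       x x' y. x \<in> carrier A \<and> x' \<in> carrier A \<and> y \<in> carrier B} \<union>
    {Poly_Mapping.single (x, y \<oplus>\<^bsub>B\<^esub> y') 1 - Poly_Mapping.single (x, y) 1
       - Poly_Mapping.single (x, y') 1 |
       x y y'. x \<in> carrier A \<and> y \<in> carrier B \<and> y' \<in> carrier B} \<union>
    {Poly_Mapping.single (c \<odot>\<^bsub>A\<^esub> x, y) 1 - Poly_Mapping.single (x, y) c |
       c x y. x \<in> carrier A \<and> y \<in> carrier B} \<union>
    {Poly_Mapping.single (x, c \<odot>\<^bsub>B\<^esub> y) 1 - Poly_Mapping.single (x, y) c |
       c x y. x \<in> carrier A \<and> y \<in> carrier B}"

definition tensor_kernel ::
    "(complex, 'a) module \<Rightarrow> (complex, 'b) module \<Rightarrow> ('a \<times> 'b \<Rightarrow>\<^sub>0 complex) set" where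
  "tensor_kernel A B = linear_span (monoid_algebra (A \<times>\<times> B)) (bilinearity_relations A B)"

definition tensor_algebra ::
    "(complex, 'a) module \<Rightarrow> (complex, 'b) module \<Rightarrow> (complex, ('a \<times> 'b \<Rightarrow>\<^sub>0 complex) set) module"
  where
  "tensor_algebra A B = quotient_algebra (monoid_algebra (A \<times>\<times> B)) (tensor_kernel A B)"

definition pure_tensor ::
    "(complex, 'a) module \<Rightarrow> (complex, 'b) module \<Rightarrow> 'a \<Rightarrow> 'b \<Rightarrow> ('a \<times> 'b \<Rightarrow>\<^sub>0 complex) set" where
  "pure_tensor A B x y =
    tensor_kernel A B +>\<^bsub>monoid_algebra (A \<times>\<times> B)\<^esub> Poly_Mapping.single (x, y) 1"

text \<open>The linear map on a tensor product induced by a map \<^term>\<open>\<beta>\<close> that is bilinear on the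
  carriers, with values in \<^term>\<open>C\<close>. For such \<^term>\<open>\<beta>\<close> all representatives of a coset have the
  same image, so that the set below is a singleton.\<close>

definition tensor_lift ::
    "(complex, 'c) module \<Rightarrow> ('a \<Rightarrow> 'b \<Rightarrow> 'c) \<Rightarrow> ('a \<times> 'b \<Rightarrow>\<^sub>0 complex) set \<Rightarrow> 'c" where
  "tensor_lift C \<beta> X = the_elem
    ((\<lambda>t. \<Oplus>\<^bsub>C\<^esub>k\<in>Poly_Mapping.keys t. Poly_Mapping.lookup t k \<odot>\<^bsub>C\<^esub> \<beta> (fst k) (snd k)) ` X)"

text \<open>The map \<open>f \<otimes> g\<close> into the tensor product of \<^term>\<open>A'\<close> and \<^term>\<open>B'\<close>.\<close>

definition tensor_map ::
    "(complex, 'c) module \<Rightarrow> (complex, 'd) module \<Rightarrow> ('a \<Rightarrow> 'c) \<Rightarrow> ('b \<Rightarrow> 'd) \<Rightarrow>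
      ('a \<times> 'b \<Rightarrow>\<^sub>0 complex) set \<Rightarrow> ('c \<times> 'd \<Rightarrow>\<^sub>0 complex) set" where
  "tensor_map A' B' f g = tensor_lift (tensor_algebra A' B') (\<lambda>x y. pure_tensor A' B' (f x) (g y))"

text \<open>The canonical identifications of \<open>(A \<otimes> B) \<otimes> C\<close> with \<open>A \<otimes> (B \<otimes> C)\<close>, and of
  \<open>\<complex> \<otimes> A\<close> and \<open>A \<otimes> \<complex>\<close> with \<open>A\<close>.\<close>

definition tensor_assoc ::
    "(complex, 'a) module \<Rightarrow> (complex, 'b) module \<Rightarrow> (complex, 'c) module \<Rightarrow>
      (('a \<times> 'b \<Rightarrow>\<^sub>0 complex) set \<times> 'c \<Rightarrow>\<^sub>0 complex) set \<Rightarrow>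
      ('a \<times> ('b \<times> 'c \<Rightarrow>\<^sub>0 complex) set \<Rightarrow>\<^sub>0 complex) set" where
  "tensor_assoc A B C =
    tensor_lift (tensor_algebra A (tensor_algebra B C))
      (\<lambda>t z. tensor_lift (tensor_algebra A (tensor_algebra B C))
        (\<lambda>x y. pure_tensor A (tensor_algebra B C) x (pure_tensor B C y z)) t)"

definition tensor_unit_left ::
    "(complex, 'a) module \<Rightarrow> (complex \<times> 'a \<Rightarrow>\<^sub>0 complex) set \<Rightarrow> 'a" where
  "tensor_unit_left A = tensor_lift A (\<lambda>c x. c \<odot>\<^bsub>A\<^esub> x)"

definition tensor_unit_right ::
    "(complex, 'a) module \<Rightarrow> ('a \<times> complex \<Rightarrow>\<^sub>0 complex) set \<Rightarrow> 'a" where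
  "tensor_unit_right A = tensor_lift A (\<lambda>x c. c \<odot>\<^bsub>A\<^esub> x)"

definition multiplication_map ::
    "(complex, 'a) module \<Rightarrow> ('a \<times> 'a \<Rightarrow>\<^sub>0 complex) set \<Rightarrow> 'a" where
  "multiplication_map A = tensor_lift A (\<lambda>x y. x \<otimes>\<^bsub>A\<^esub> y)"

locale hopf_algebra = complex_algebra A
  for A :: "(complex, 'a) module" (structure)
    and \<Delta> :: "'a \<Rightarrow> ('a \<times> 'a \<Rightarrow>\<^sub>0 complex) set"
    and \<epsilon> :: "'a \<Rightarrow> complex"
    and S :: "'a \<Rightarrow> 'a" +
  assumes coproduct_hom: "\<Delta> \<in> algebra_hom A (tensor_algebra A A)"
    and counit_hom: "\<epsilon> \<in> algebra_hom A complex_alg"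
    and antipode_linear: "S \<in> linear_maps A A"
    and coassociative: "x \<in> carrier A \<Longrightarrow>
      tensor_assoc A A A (tensor_map (tensor_algebra A A) A \<Delta> id (\<Delta> x)) =
      tensor_map A (tensor_algebra A A) id \<Delta> (\<Delta> x)"
    and counit_left: "x \<in> carrier A \<Longrightarrow>
      tensor_unit_left A (tensor_map complex_alg A \<epsilon> id (\<Delta> x)) = x"
    and counit_right: "x \<in> carrier A \<Longrightarrow>
      tensor_unit_right A (tensor_map A complex_alg id \<epsilon> (\<Delta> x)) = x"
    and antipode_left: "x \<in> carrier A \<Longrightarrow>
      multiplication_map A (tensor_map A A S id (\<Delta> x)) = \<epsilon> x \<odot> \<one>"
    and antipode_right: "x \<in> carrier A \<Longrightarrow>
      multiplication_map A (tensor_map A A id S (\<Delta> x)) = \<epsilon> x \<odot> \<one>"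

datatype generator = P nat | Q nat | Y nat | Eps

definition heisenberg_variables :: "nat \<Rightarrow> nat \<Rightarrow> generator set" where
  "heisenberg_variables r s = P ` {1..r} \<union> Q ` {1..r} \<union> Y ` {1..s}"

definition heisenberg_generators :: "nat \<Rightarrow> nat \<Rightarrow> generator set" where
  "heisenberg_generators r s = insert Eps (heisenberg_variables r s)"

text \<open>The prescribed value of the commutator of two generators.\<close>

fun heisenberg_bracket :: "generator \<Rightarrow> generator \<Rightarrow> (generator list \<Rightarrow>\<^sub>0 complex)" where
  "heisenberg_bracket (P j) (Q k) = (if j = k then Poly_Mapping.single [Eps] \<i> else 0)"
| "heisenberg_bracket (Q k) (P j) = (if j = k then Poly_Mapping.single [Eps] (- \<i>) else 0)"
| "heisenberg_bracket _ _ = 0"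

definition heisenberg_relations :: "nat \<Rightarrow> nat \<Rightarrow> (generator list \<Rightarrow>\<^sub>0 complex) set" where
  "heisenberg_relations r s =
    {Poly_Mapping.single [a, b] 1 - Poly_Mapping.single [b, a] 1 - heisenberg_bracket a b |
       a b. a \<in> heisenberg_generators r s \<and> b \<in> heisenberg_generators r s}"

definition heisenberg_ideal :: "nat \<Rightarrow> nat \<Rightarrow> (generator list \<Rightarrow>\<^sub>0 complex) set" where
  "heisenberg_ideal r s =
    Idl\<^bsub>free_algebra (heisenberg_generators r s)\<^esub> (heisenberg_relations r s)"

definition heisenberg_algebra ::
    "nat \<Rightarrow> nat \<Rightarrow> (complex, (generator list \<Rightarrow>\<^sub>0 complex) set) module" where
  "heisenberg_algebra r s =
    quotient_algebra (free_algebra (heisenberg_generators r s)) (heisenberg_ideal r s)"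

definition heisenberg_gen :: "nat \<Rightarrow> nat \<Rightarrow> generator \<Rightarrow> (generator list \<Rightarrow>\<^sub>0 complex) set" where
  "heisenberg_gen r s a =
    heisenberg_ideal r s +>\<^bsub>free_algebra (heisenberg_generators r s)\<^esub> Poly_Mapping.single [a] 1"

end

theory Submission
  imports Defs
begin

text \<open>
  The relations say that \<open>[a, b]\<close> is a multiple of the central generator, which is itself
  primitive. Hence the elements \<open>a \<otimes> 1 + 1 \<otimes> a\<close> satisfy the relations in \<open>H \<otimes> H\<close> (the mixed
  terms \<open>a \<otimes> b + b \<otimes> a\<close> are symmetric), the zeros satisfy them in \<open>\<complex>\<close>, and the \<open>-a\<close> satisfy
  them in the opposite algebra of \<open>H\<close>; so the three structure maps exist. No basis of \<open>H\<close> is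
  needed. Coassociativity and the counit laws equate algebra homomorphisms and need only be checked on
  generators. The antipode laws do not have this form, but they pass to products: for
  \<open>\<mu> (x \<otimes> y) = S(x) y\<close> and \<open>\<mu> t = c 1\<close> one has \<open>\<mu> (t u) = c \<mu> u\<close>.
\<close>

section \<open>Complex algebras and linear maps\<close>

text \<open>The obstacle is the concreteness of the tensor product. Its kernel is given only as a
  linear span, so it must be shown to absorb multiplication before H \<otimes> H is an algebra at
  all. A map out of it is given as the common value on a coset, so it is meaningful only once its
  linear extension is known to kill the bilinearity relations. After that, two principles carry the
  work: a linear map out of a tensor product is determined by its values on pure tensors, and it is
  an algebra homomorphism as soon as it respects the unit and products of pure tensors. The antipode
  laws resist a comparison of homomorphisms because the multiplication H \<otimes> H \<rightarrow> H
  is not multiplicative when H is noncommutative, and S reverses products. The same reversal rescues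
  them: S(x y) x' y' = S(y) (S(x) x') y', so the factors coming from x \<otimes> x' meet in the
  middle, and a scalar there can be moved out.\<close>

lemma complex_alg_simps [simp]:
  "carrier complex_alg = UNIV" "mult complex_alg = (*)" "one complex_alg = 1"
  "zero complex_alg = 0" "add complex_alg = (+)" "smult complex_alg = (*)"
  by (simp_all add: complex_alg_def)

lemma cring_complex_alg: "cring complex_alg"
proof (rule cringI)
  show "abelian_group complex_alg"
    by (rule abelian_groupI) (auto simp: algebra_simps intro: exI[of _ "- x" for x])
  show "comm_monoid complex_alg"
    by (rule comm_monoidI) (auto simp: algebra_simps)
qed (auto simp: algebra_simps)

lemma complex_algebraI:
  assumes "ring A"
    and "\<And>c x. x \<in> carrier A \<Longrightarrow> c \<odot>\<^bsub>A\<^esub> x \<in> carrier A"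
    and "\<And>c d x. x \<in> carrier A \<Longrightarrow> (c + d) \<odot>\<^bsub>A\<^esub> x = c \<odot>\<^bsub>A\<^esub> x \<oplus>\<^bsub>A\<^esub> d \<odot>\<^bsub>A\<^esub> x"
    and "\<And>c x y. \<lbrakk>x \<in> carrier A; y \<in> carrier A\<rbrakk> \<Longrightarrow>
      c \<odot>\<^bsub>A\<^esub> (x \<oplus>\<^bsub>A\<^esub> y) = c \<odot>\<^bsub>A\<^esub> x \<oplus>\<^bsub>A\<^esub> c \<odot>\<^bsub>A\<^esub> y"
    and "\<And>c d x. x \<in> carrier A \<Longrightarrow> (c * d) \<odot>\<^bsub>A\<^esub> x = c \<odot>\<^bsub>A\<^esub> (d \<odot>\<^bsub>A\<^esub> x)"
    and "\<And>x. x \<in> carrier A \<Longrightarrow> 1 \<odot>\<^bsub>A\<^esub> x = x"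
    and "\<And>c x y. \<lbrakk>x \<in> carrier A; y \<in> carrier A\<rbrakk> \<Longrightarrow>
      (c \<odot>\<^bsub>A\<^esub> x) \<otimes>\<^bsub>A\<^esub> y = c \<odot>\<^bsub>A\<^esub> (x \<otimes>\<^bsub>A\<^esub> y)"
    and "\<And>c x y. \<lbrakk>x \<in> carrier A; y \<in> carrier A\<rbrakk> \<Longrightarrow>
      x \<otimes>\<^bsub>A\<^esub> (c \<odot>\<^bsub>A\<^esub> y) = c \<odot>\<^bsub>A\<^esub> (x \<otimes>\<^bsub>A\<^esub> y)"
  shows "complex_algebra A"
proof -
  interpret ring A by fact
  have "module complex_alg A"
    by (rule moduleI[OF cring_complex_alg is_abelian_group]) (use assms in auto)
  then show ?thesis
    by (intro complex_algebra.intro complex_algebra_axioms.intro assms)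
qed

lemma complex_algebra_complex_alg: "complex_algebra complex_alg"
  using cring.axioms(1)[OF cring_complex_alg]
  by (intro complex_algebraI) (auto simp: algebra_simps)

lemma linear_mapsI:
  assumes "\<And>x. x \<in> carrier A \<Longrightarrow> f x \<in> carrier B"
    and "\<And>x y. \<lbrakk>x \<in> carrier A; y \<in> carrier A\<rbrakk> \<Longrightarrow> f (x \<oplus>\<^bsub>A\<^esub> y) = f x \<oplus>\<^bsub>B\<^esub> f y"
    and "\<And>c x. x \<in> carrier A \<Longrightarrow> f (c \<odot>\<^bsub>A\<^esub> x) = c \<odot>\<^bsub>B\<^esub> f x"
  shows "f \<in> linear_maps A B"
  using assms by (auto simp: linear_maps_def)

lemma linear_mapsD:
  assumes "f \<in> linear_maps A B"
  shows "x \<in> carrier A \<Longrightarrow> f x \<in> carrier B"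
    and "\<lbrakk>x \<in> carrier A; y \<in> carrier A\<rbrakk> \<Longrightarrow> f (x \<oplus>\<^bsub>A\<^esub> y) = f x \<oplus>\<^bsub>B\<^esub> f y"
    and "x \<in> carrier A \<Longrightarrow> f (c \<odot>\<^bsub>A\<^esub> x) = c \<odot>\<^bsub>B\<^esub> f x"
  using assms by (auto simp: linear_maps_def)

lemma linear_maps_id: "id \<in> linear_maps A A"
  by (rule linear_mapsI) auto

lemma linear_maps_comp:
  assumes "f \<in> linear_maps A B" "g \<in> linear_maps B C"
  shows "(\<lambda>x. g (f x)) \<in> linear_maps A C"
  by (rule linear_mapsI) (auto simp: assms linear_mapsD[OF assms(1)] linear_mapsD[OF assms(2)])

lemma algebra_homI:
  assumes "f \<in> linear_maps A B" "f \<one>\<^bsub>A\<^esub> = \<one>\<^bsub>B\<^esub>"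
    and "\<And>x y. \<lbrakk>x \<in> carrier A; y \<in> carrier A\<rbrakk> \<Longrightarrow> f (x \<otimes>\<^bsub>A\<^esub> y) = f x \<otimes>\<^bsub>B\<^esub> f y"
  shows "f \<in> algebra_hom A B"
  using assms by (auto simp: algebra_hom_def linear_mapsD[OF assms(1)] intro!: ring_hom_memI)

lemma algebra_homD:
  assumes "f \<in> algebra_hom A B"
  shows "f \<in> linear_maps A B"
    and "x \<in> carrier A \<Longrightarrow> f x \<in> carrier B"
    and "\<lbrakk>x \<in> carrier A; y \<in> carrier A\<rbrakk> \<Longrightarrow> f (x \<oplus>\<^bsub>A\<^esub> y) = f x \<oplus>\<^bsub>B\<^esub> f y"
    and "x \<in> carrier A \<Longrightarrow> f (c \<odot>\<^bsub>A\<^esub> x) = c \<odot>\<^bsub>B\<^esub> f x"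
    and "f \<one>\<^bsub>A\<^esub> = \<one>\<^bsub>B\<^esub>"
    and "\<lbrakk>x \<in> carrier A; y \<in> carrier A\<rbrakk> \<Longrightarrow> f (x \<otimes>\<^bsub>A\<^esub> y) = f x \<otimes>\<^bsub>B\<^esub> f y"
  using assms by (auto simp: algebra_hom_def linear_maps_def dest: ring_hom_one ring_hom_mult)

lemma algebra_hom_id: "id \<in> algebra_hom A A"
  by (rule algebra_homI) (auto simp: linear_maps_id)

lemma algebra_hom_comp:
  assumes "f \<in> algebra_hom A B" "g \<in> algebra_hom B C"
  shows "(\<lambda>x. g (f x)) \<in> algebra_hom A C"
  by (rule algebra_homI)
    (auto simp: linear_maps_comp[of f A B] algebra_homD[OF assms(1)] algebra_homD[OF assms(2)])

context complex_algebra
begin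

lemma complex_algebra: "complex_algebra A" ..

lemma scalar_simps [simp]:
  assumes "x \<in> carrier A"
  shows "c \<odot> x \<in> carrier A" "1 \<odot> x = x" "0 \<odot> x = \<zero>\<^bsub>A\<^esub>"
  using assms smult_one[of x] smult_l_null[of x] by auto

lemma smult_minus_one: "x \<in> carrier A \<Longrightarrow> (- 1) \<odot> x = \<ominus>\<^bsub>A\<^esub> x"
proof -
  assume x: "x \<in> carrier A"
  have "(- 1) \<odot> x \<oplus>\<^bsub>A\<^esub> x = ((- 1) + 1) \<odot> x"
    using smult_l_distr[of "- 1" 1 x] smult_one[OF x] x by simp
  also have "\<dots> = \<zero>\<^bsub>A\<^esub>"
    using smult_l_null[OF x] by simp
  finally show ?thesis
    using x by (simp add: minus_equality)
qed

lemma linear_smult: "(\<odot>) c \<in> linear_maps A A"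
  by (rule linear_mapsI) (auto simp: smult_r_distr smult_assoc1[symmetric, simplified] mult.commute)

lemma linear_mult_left: "x \<in> carrier A \<Longrightarrow> (\<otimes>) x \<in> linear_maps A A"
  by (rule linear_mapsI) (auto simp: r_distr smult_mult_right)

lemma linear_mult_right: "y \<in> carrier A \<Longrightarrow> (\<lambda>x. x \<otimes> y) \<in> linear_maps A A"
  by (rule linear_mapsI) (auto simp: l_distr smult_mult_left)

lemma linear_smult_left: "x \<in> carrier A \<Longrightarrow> (\<lambda>c. c \<odot> x) \<in> linear_maps complex_alg A"
  using smult_l_distr[of _ _ x] smult_assoc1[of _ _ x]
  by (intro linear_mapsI) auto

end

text \<open>Preservation of zero is not part of \<open>linear_maps\<close>; it comes from
  compatibility with the scalar 0.\<close>

lemma linear_map_zero: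
  assumes "complex_algebra A" "complex_algebra B" "f \<in> linear_maps A B"
  shows "f \<zero>\<^bsub>A\<^esub> = \<zero>\<^bsub>B\<^esub>"
proof -
  interpret A: complex_algebra A by fact
  interpret B: complex_algebra B by fact
  have "f (0 \<odot>\<^bsub>A\<^esub> \<zero>\<^bsub>A\<^esub>) = 0 \<odot>\<^bsub>B\<^esub> f \<zero>\<^bsub>A\<^esub>"
    by (rule linear_mapsD[OF assms(3)]) auto
  then show ?thesis
    using A.smult_l_null B.smult_l_null linear_mapsD(1)[OF assms(3), of "\<zero>\<^bsub>A\<^esub>"] by simp
qed

lemma linear_map_a_inv:
  assumes "complex_algebra A" "complex_algebra B" "f \<in> linear_maps A B" "x \<in> carrier A"
  shows "f (\<ominus>\<^bsub>A\<^esub> x) = \<ominus>\<^bsub>B\<^esub> f x"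
  using assms linear_mapsD[OF assms(3)]
  by (simp add: complex_algebra.smult_minus_one[symmetric])

lemma linear_map_minus:
  assumes "complex_algebra A" "complex_algebra B" "f \<in> linear_maps A B"
    "x \<in> carrier A" "y \<in> carrier A"
  shows "f (x \<ominus>\<^bsub>A\<^esub> y) = f x \<ominus>\<^bsub>B\<^esub> f y"
proof -
  interpret A: complex_algebra A by fact
  interpret B: complex_algebra B by fact
  show ?thesis
    using assms by (simp add: a_minus_def linear_mapsD[OF assms(3)] linear_map_a_inv)
qed

section \<open>Monoid algebras\<close>

lemma map_times_zero [simp]: "Poly_Mapping.map ((*) (c :: 'a :: mult_zero)) 0 = 0"
  by (simp add: map_eq_zero_iff)

lemma map_times_single [simp]:
  "Poly_Mapping.map ((*) (c :: 'a :: mult_zero)) (Poly_Mapping.single k d) =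
   Poly_Mapping.single k (c * d)"
  by (rule poly_mapping_eqI) (simp add: Poly_Mapping.map.rep_eq lookup_single when_def)

lemma lookup_map_times [simp]:
  "Poly_Mapping.lookup (Poly_Mapping.map ((*) c) f) k = c * Poly_Mapping.lookup f k"
  for c :: "'a :: mult_zero"
  by (simp add: Poly_Mapping.map.rep_eq when_def)

lemma map_times_add:
  "Poly_Mapping.map ((*) (c :: 'a :: semiring_0)) (f + g) =
   Poly_Mapping.map ((*) c) f + Poly_Mapping.map ((*) c) g"
  by (rule poly_mapping_eqI) (simp add: lookup_add algebra_simps)

lemma monoid_algebra_simps:
  "carrier (monoid_algebra G) = {f. Poly_Mapping.keys f \<subseteq> carrier G}"
  "one (monoid_algebra G) = Poly_Mapping.single \<one>\<^bsub>G\<^esub> 1"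
  "zero (monoid_algebra G) = 0"
  "add (monoid_algebra G) = (+)"
  "smult (monoid_algebra G) = (\<lambda>c. Poly_Mapping.map ((*) c))"
  by (simp_all add: monoid_algebra_def)

text \<open>Supports behave badly under addition, since coefficients can cancel. Enlarging the index
  sets adds only terms with coefficient 0, so several products can be written over the same K and L
  and then compared term by term.\<close>

lemma monoid_algebra_mult_eq_sum:
  assumes "finite K" "Poly_Mapping.keys f \<subseteq> K" "finite L" "Poly_Mapping.keys g \<subseteq> L"
  shows "f \<otimes>\<^bsub>monoid_algebra G\<^esub> g = (\<Sum>x\<in>K. \<Sum>y\<in>L. Poly_Mapping.single (x \<otimes>\<^bsub>G\<^esub> y)
    (Poly_Mapping.lookup f x * Poly_Mapping.lookup g y))"
proof -
  have "(\<Sum>y\<in>Poly_Mapping.keys g. Poly_Mapping.single (x \<otimes>\<^bsub>G\<^esub> y)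
      (Poly_Mapping.lookup f x * Poly_Mapping.lookup g y)) =
    (\<Sum>y\<in>L. Poly_Mapping.single (x \<otimes>\<^bsub>G\<^esub> y)
      (Poly_Mapping.lookup f x * Poly_Mapping.lookup g y))" for x
    using assms by (intro sum.mono_neutral_left) (auto simp: in_keys_iff)
  then have "f \<otimes>\<^bsub>monoid_algebra G\<^esub> g = (\<Sum>x\<in>Poly_Mapping.keys f. \<Sum>y\<in>L.
    Poly_Mapping.single (x \<otimes>\<^bsub>G\<^esub> y) (Poly_Mapping.lookup f x * Poly_Mapping.lookup g y))"
    by (simp add: monoid_algebra_def)
  also have "\<dots> = (\<Sum>x\<in>K. \<Sum>y\<in>L.
    Poly_Mapping.single (x \<otimes>\<^bsub>G\<^esub> y) (Poly_Mapping.lookup f x * Poly_Mapping.lookup g y))"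
    using assms by (intro sum.mono_neutral_left) (auto simp: in_keys_iff)
  finally show ?thesis .
qed

lemma monoid_algebra_mult_single:
  "Poly_Mapping.single x c \<otimes>\<^bsub>monoid_algebra G\<^esub> Poly_Mapping.single y d =
   Poly_Mapping.single (x \<otimes>\<^bsub>G\<^esub> y) (c * d)"
  by (subst monoid_algebra_mult_eq_sum[of "{x}" _ "{y}"]) auto

lemma monoid_algebra_mult_add_left:
  "(f + f') \<otimes>\<^bsub>monoid_algebra G\<^esub> g = f \<otimes>\<^bsub>monoid_algebra G\<^esub> g + f' \<otimes>\<^bsub>monoid_algebra G\<^esub> g"
proof -
  let ?K = "Poly_Mapping.keys f \<union> Poly_Mapping.keys f'"
  show ?thesis
    using keys_add[of f f']
    by (subst (1 2 3) monoid_algebra_mult_eq_sum[where K = ?K and L = "Poly_Mapping.keys g"])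
      (auto simp: lookup_add single_add algebra_simps sum.distrib)
qed

lemma monoid_algebra_mult_add_right:
  "f \<otimes>\<^bsub>monoid_algebra G\<^esub> (g + g') = f \<otimes>\<^bsub>monoid_algebra G\<^esub> g + f \<otimes>\<^bsub>monoid_algebra G\<^esub> g'"
proof -
  let ?L = "Poly_Mapping.keys g \<union> Poly_Mapping.keys g'"
  show ?thesis
    using keys_add[of g g']
    by (subst (1 2 3) monoid_algebra_mult_eq_sum[where L = ?L and K = "Poly_Mapping.keys f"])
      (auto simp: lookup_add single_add algebra_simps sum.distrib)
qed

lemma monoid_algebra_mult_zero [simp]:
  "0 \<otimes>\<^bsub>monoid_algebra G\<^esub> g = 0" "f \<otimes>\<^bsub>monoid_algebra G\<^esub> 0 = 0"
  by (simp_all add: monoid_algebra_def)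

text \<open>An element is the finite sum of its one-term parts. The single case allows an arbitrary
  coefficient, which replaces a separate case for scalar multiples; the partial sums are kept in the
  carrier so that the addition case may assume membership.\<close>

lemma monoid_algebra_induct [consumes 1, case_names zero single add]:
  assumes "f \<in> carrier (monoid_algebra G)"
    and "\<Phi> 0"
    and "\<And>k c. k \<in> carrier G \<Longrightarrow> \<Phi> (Poly_Mapping.single k c)"
    and "\<And>f g. \<lbrakk>f \<in> carrier (monoid_algebra G); g \<in> carrier (monoid_algebra G); \<Phi> f; \<Phi> g\<rbrakk>
      \<Longrightarrow> \<Phi> (f + g)"
  shows "\<Phi> f"
proof -
  let ?s = "\<lambda>K. \<Sum>k\<in>K. Poly_Mapping.single k (Poly_Mapping.lookup f k)"
  have "?s K \<in> carrier (monoid_algebra G) \<and> \<Phi> (?s K)" if "finite K" "K \<subseteq> carrier G" for K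
    using that
  proof induction
    case empty
    then show ?case using assms(2) by (simp add: monoid_algebra_simps)
  next
    case (insert k K)
    have "Poly_Mapping.single k (Poly_Mapping.lookup f k) \<in> carrier (monoid_algebra G)"
      using insert by (auto simp: monoid_algebra_simps)
    then show ?case
      using insert assms(3)[of k] assms(4)[of "Poly_Mapping.single k (Poly_Mapping.lookup f k)" "?s K"]
        keys_add[of "Poly_Mapping.single k (Poly_Mapping.lookup f k)" "?s K"]
      by (auto simp: monoid_algebra_simps)
  qed
  moreover have "?s (Poly_Mapping.keys f) = f"
    by (rule poly_mapping_eqI)
      (auto simp: lookup_sum lookup_single when_def sum.delta' not_in_keys_iff_lookup_eq_zero
        sum.delta)
  ultimately show ?thesis
    using assms(1) by (metis finite_keys mem_Collect_eq monoid_algebra_simps(1))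
qed

lemma monoid_algebra_closed:
  assumes "f \<in> carrier (monoid_algebra G)" "g \<in> carrier (monoid_algebra G)"
  shows "f + g \<in> carrier (monoid_algebra G)"
    and "f - g \<in> carrier (monoid_algebra G)"
    and "- f \<in> carrier (monoid_algebra G)"
    and "Poly_Mapping.map ((*) c) f \<in> carrier (monoid_algebra G)"
    and "Poly_Mapping.single k d \<in> carrier (monoid_algebra G) \<longleftrightarrow> k \<in> carrier G \<or> d = 0"
  using assms keys_add[of f g] keys_diff[of f g]
  by (auto simp: monoid_algebra_simps in_keys_iff)

lemma single_in_monoid_algebra:
  "k \<in> carrier G \<Longrightarrow> Poly_Mapping.single k d \<in> carrier (monoid_algebra G)"
  by (simp add: monoid_algebra_simps)

lemma zero_in_monoid_algebra: "0 \<in> carrier (monoid_algebra G)"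
  by (simp add: monoid_algebra_simps)

text \<open>Both distributive laws are already available, so every remaining law is additive in each
  argument. Nested inductions reduce it to one-term elements, where it is a law of the monoid
  combined with one of complex multiplication.\<close>

lemma complex_algebra_monoid_algebra:
  assumes "monoid G"
  shows "complex_algebra (monoid_algebra G)"
proof -
  interpret G: monoid G by fact
  let ?M = "monoid_algebra G"
  note simps = monoid_algebra_simps(2-5)
  have mult_closed: "f \<otimes>\<^bsub>?M\<^esub> g \<in> carrier ?M" if f: "f \<in> carrier ?M" and g: "g \<in> carrier ?M" for f g
    using f
  proof (induction rule: monoid_algebra_induct)
    case (single k c)
    from g show ?case
      by (induction rule: monoid_algebra_induct)
        (auto simp: monoid_algebra_mult_single monoid_algebra_mult_add_right single
          intro: monoid_algebra_closed single_in_monoid_algebra zero_in_monoid_algebra)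
  qed (auto simp: monoid_algebra_mult_add_left intro: monoid_algebra_closed zero_in_monoid_algebra)
  have smult_left: "Poly_Mapping.map ((*) c) f \<otimes>\<^bsub>?M\<^esub> g = Poly_Mapping.map ((*) c) (f \<otimes>\<^bsub>?M\<^esub> g)"
    and smult_right: "f \<otimes>\<^bsub>?M\<^esub> Poly_Mapping.map ((*) c) g = Poly_Mapping.map ((*) c) (f \<otimes>\<^bsub>?M\<^esub> g)"
    if f: "f \<in> carrier ?M" and g: "g \<in> carrier ?M" for c f g
  proof -
    have "Poly_Mapping.map ((*) c) (Poly_Mapping.single k d) \<otimes>\<^bsub>?M\<^esub> g =
        Poly_Mapping.map ((*) c) (Poly_Mapping.single k d \<otimes>\<^bsub>?M\<^esub> g) \<and>
      Poly_Mapping.single k d \<otimes>\<^bsub>?M\<^esub> Poly_Mapping.map ((*) c) g =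
        Poly_Mapping.map ((*) c) (Poly_Mapping.single k d \<otimes>\<^bsub>?M\<^esub> g)" for k d
      using g by (induction rule: monoid_algebra_induct)
        (auto simp: monoid_algebra_mult_single monoid_algebra_mult_add_right
          map_times_add mult.assoc mult.left_commute)
    with f have "Poly_Mapping.map ((*) c) f \<otimes>\<^bsub>?M\<^esub> g = Poly_Mapping.map ((*) c) (f \<otimes>\<^bsub>?M\<^esub> g) \<and>
      f \<otimes>\<^bsub>?M\<^esub> Poly_Mapping.map ((*) c) g = Poly_Mapping.map ((*) c) (f \<otimes>\<^bsub>?M\<^esub> g)"
      by (induction rule: monoid_algebra_induct)
        (auto simp: monoid_algebra_mult_add_left map_times_add)
    then show "Poly_Mapping.map ((*) c) f \<otimes>\<^bsub>?M\<^esub> g = Poly_Mapping.map ((*) c) (f \<otimes>\<^bsub>?M\<^esub> g)"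
      "f \<otimes>\<^bsub>?M\<^esub> Poly_Mapping.map ((*) c) g = Poly_Mapping.map ((*) c) (f \<otimes>\<^bsub>?M\<^esub> g)" by auto
  qed
  have assoc: "(f \<otimes>\<^bsub>?M\<^esub> g) \<otimes>\<^bsub>?M\<^esub> h = f \<otimes>\<^bsub>?M\<^esub> (g \<otimes>\<^bsub>?M\<^esub> h)"
    if f: "f \<in> carrier ?M" and g: "g \<in> carrier ?M" and h: "h \<in> carrier ?M" for f g h
    using f
  proof (induction rule: monoid_algebra_induct)
    case (single k c)
    from g show ?case
    proof (induction rule: monoid_algebra_induct)
      case (single l d)
      from h show ?case
        by (induction rule: monoid_algebra_induct)
          (auto simp: monoid_algebra_mult_single monoid_algebra_mult_add_right
            single \<open>k \<in> carrier G\<close> G.m_assoc mult.assoc)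
    qed (auto simp: monoid_algebra_mult_add_left monoid_algebra_mult_add_right)
  qed (auto simp: monoid_algebra_mult_add_left)
  have one: "Poly_Mapping.single \<one>\<^bsub>G\<^esub> 1 \<otimes>\<^bsub>?M\<^esub> f = f \<and> f \<otimes>\<^bsub>?M\<^esub> Poly_Mapping.single \<one>\<^bsub>G\<^esub> 1 = f"
    if f: "f \<in> carrier ?M" for f
    using f by (induction rule: monoid_algebra_induct)
      (auto simp: monoid_algebra_mult_single monoid_algebra_mult_add_left
        monoid_algebra_mult_add_right)
  show ?thesis
  proof (rule complex_algebraI)
    show "ring ?M"
    proof (rule ringI)
      show "abelian_group ?M"
        by (rule abelian_groupI)
          (auto simp: simps add.assoc intro: monoid_algebra_closed zero_in_monoid_algebra
            add.commute bexI[of _ "- x" for x])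
      show "monoid ?M"
        using mult_closed assoc one single_in_monoid_algebra[OF G.one_closed]
        by (intro monoidI) (auto simp: simps)
    qed (auto simp: simps monoid_algebra_mult_add_left monoid_algebra_mult_add_right)
  qed (auto simp: simps monoid_algebra_closed map_times_add smult_left smult_right
      intro!: poly_mapping_eqI simp: lookup_add algebra_simps)
qed

lemma monoid_algebra_mult_minus_left:
  "(f - f') \<otimes>\<^bsub>monoid_algebra G\<^esub> g = f \<otimes>\<^bsub>monoid_algebra G\<^esub> g - f' \<otimes>\<^bsub>monoid_algebra G\<^esub> g"
  using monoid_algebra_mult_add_left[where f = "f - f'" and f' = f' and G = G and g = g]
  by (simp add: algebra_simps)

lemma monoid_algebra_mult_minus_right:
  "f \<otimes>\<^bsub>monoid_algebra G\<^esub> (g - g') = f \<otimes>\<^bsub>monoid_algebra G\<^esub> g - f \<otimes>\<^bsub>monoid_algebra G\<^esub> g'"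
  using monoid_algebra_mult_add_right[where g = "g - g'" and g' = g' and G = G and f = f]
  by (simp add: algebra_simps)

text \<open>Relations are written with the subtraction of finitely supported functions, while facts
  about ideals and linear maps use the subtraction of the algebra. This and the next lemma translate
  between the two.\<close>

lemma monoid_algebra_a_inv:
  assumes "monoid G" "f \<in> carrier (monoid_algebra G)"
  shows "\<ominus>\<^bsub>monoid_algebra G\<^esub> f = - f"
proof -
  interpret complex_algebra "monoid_algebra G"
    by (rule complex_algebra_monoid_algebra) fact
  show ?thesis
    using assms by (intro minus_equality) (auto simp: monoid_algebra_simps)
qed

lemma monoid_algebra_a_minus:
  assumes "monoid G" "g \<in> carrier (monoid_algebra G)"
  shows "f \<ominus>\<^bsub>monoid_algebra G\<^esub> g = f - g"
  using assms by (simp add: a_minus_def monoid_algebra_a_inv monoid_algebra_simps(4))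

section \<open>Linear maps out of a monoid algebra: uniqueness and extension from the basis\<close>

lemma linear_maps_monoid_algebra_eqI:
  assumes "monoid G" "complex_algebra C"
    and f: "f \<in> linear_maps (monoid_algebra G) C" and g: "g \<in> linear_maps (monoid_algebra G) C"
    and eq: "\<And>k. k \<in> carrier G \<Longrightarrow> f (Poly_Mapping.single k 1) = g (Poly_Mapping.single k 1)"
    and "t \<in> carrier (monoid_algebra G)"
  shows "f t = g t"
  using assms(6)
proof (induction rule: monoid_algebra_induct)
  case zero
  show ?case
    using linear_map_zero[OF complex_algebra_monoid_algebra[OF assms(1)] assms(2) f]
      linear_map_zero[OF complex_algebra_monoid_algebra[OF assms(1)] assms(2) g]
    by (simp add: monoid_algebra_simps)
next
  case (single k c)
  then show ?case
    using linear_mapsD(3)[OF f, of "Poly_Mapping.single k 1" c]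
      linear_mapsD(3)[OF g, of "Poly_Mapping.single k 1" c] eq
    by (simp add: monoid_algebra_simps)
next
  case (add t u)
  then show ?case
    using linear_mapsD(2)[OF f] linear_mapsD(2)[OF g] by (simp add: monoid_algebra_simps)
qed

text \<open>This is the sum inside \<open>tensor_lift\<close>, freed from the index type of pairs.
  The same construction then serves tensor products, with basis the pairs, and free algebras, with
  basis the words.\<close>

definition linear_extension ::
    "(complex, 'c) module \<Rightarrow> ('g \<Rightarrow> 'c) \<Rightarrow> ('g \<Rightarrow>\<^sub>0 complex) \<Rightarrow> 'c" where
  "linear_extension C \<phi> t =
    (\<Oplus>\<^bsub>C\<^esub>k\<in>Poly_Mapping.keys t. Poly_Mapping.lookup t k \<odot>\<^bsub>C\<^esub> \<phi> k)"

context
  fixes G :: "('g, 'm) monoid_scheme" and C :: "(complex, 'c) module" and \<phi> :: "'g \<Rightarrow> 'c"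
  assumes C: "complex_algebra C"
    and \<phi>: "\<And>k. k \<in> carrier G \<Longrightarrow> \<phi> k \<in> carrier C"
begin

interpretation C: complex_algebra C by (rule C)

text \<open>The additional terms have the form 0 \<odot> \<phi> k and vanish because K stays inside
  the carrier of G, where \<phi> takes values in C. A common index set is what makes additivity
  provable despite cancellation in the support.\<close>

lemma linear_extension_eq_finsum:
  assumes "finite K" "Poly_Mapping.keys t \<subseteq> K" "K \<subseteq> carrier G"
  shows "linear_extension C \<phi> t = (\<Oplus>\<^bsub>C\<^esub>k\<in>K. Poly_Mapping.lookup t k \<odot>\<^bsub>C\<^esub> \<phi> k)"
  unfolding linear_extension_def
  by (rule C.add.finprod_mono_neutral_cong_left)
    (use assms \<phi> C.smult_l_null in \<open>auto simp: in_keys_iff\<close>)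

lemma linear_extension_linear: "linear_extension C \<phi> \<in> linear_maps (monoid_algebra G) C"
proof (rule linear_mapsI)
  fix t assume t: "t \<in> carrier (monoid_algebra G)"
  then show "linear_extension C \<phi> t \<in> carrier C"
    using \<phi> by (auto simp: linear_extension_def monoid_algebra_simps intro!: C.finsum_closed)
  fix c
  have "linear_extension C \<phi> (Poly_Mapping.map ((*) c) t) =
    (\<Oplus>\<^bsub>C\<^esub>k\<in>Poly_Mapping.keys t. (c * Poly_Mapping.lookup t k) \<odot>\<^bsub>C\<^esub> \<phi> k)"
    using t by (subst linear_extension_eq_finsum[of "Poly_Mapping.keys t"])
      (auto simp: monoid_algebra_simps in_keys_iff)
  also have "\<dots> = (\<Oplus>\<^bsub>C\<^esub>k\<in>Poly_Mapping.keys t. c \<odot>\<^bsub>C\<^esub> (Poly_Mapping.lookup t k \<odot>\<^bsub>C\<^esub> \<phi> k))"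
    using t \<phi> C.smult_assoc1[of c]
    by (intro C.add.finprod_cong') (auto simp: monoid_algebra_simps subset_iff)
  also have "\<dots> = c \<odot>\<^bsub>C\<^esub> linear_extension C \<phi> t"
    unfolding linear_extension_def
    using t \<phi> by (subst C.finsum_smult_ldistr) (auto simp: monoid_algebra_simps subset_iff)
  finally show "linear_extension C \<phi> (c \<odot>\<^bsub>monoid_algebra G\<^esub> t) = c \<odot>\<^bsub>C\<^esub> linear_extension C \<phi> t"
    by (simp add: monoid_algebra_simps)
next
  fix t u assume tu: "t \<in> carrier (monoid_algebra G)" "u \<in> carrier (monoid_algebra G)"
  let ?K = "Poly_Mapping.keys t \<union> Poly_Mapping.keys u"
  have K: "finite ?K" "?K \<subseteq> carrier G"
    using tu by (auto simp: monoid_algebra_simps)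
  then have \<phi>_K: "\<phi> k \<in> carrier C" if "k \<in> ?K" for k
    using that \<phi> by blast
  have "linear_extension C \<phi> (t + u) =
      (\<Oplus>\<^bsub>C\<^esub>k\<in>?K. Poly_Mapping.lookup (t + u) k \<odot>\<^bsub>C\<^esub> \<phi> k)"
    using K keys_add[of t u] by (intro linear_extension_eq_finsum)
  also have "\<dots> = (\<Oplus>\<^bsub>C\<^esub>k\<in>?K. Poly_Mapping.lookup t k \<odot>\<^bsub>C\<^esub> \<phi> k \<oplus>\<^bsub>C\<^esub>
      Poly_Mapping.lookup u k \<odot>\<^bsub>C\<^esub> \<phi> k)"
    using \<phi>_K C.smult_l_distr by (intro C.add.finprod_cong') (auto simp: lookup_add Pi_iff)
  also have "\<dots> = (\<Oplus>\<^bsub>C\<^esub>k\<in>?K. Poly_Mapping.lookup t k \<odot>\<^bsub>C\<^esub> \<phi> k) \<oplus>\<^bsub>C\<^esub>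
      (\<Oplus>\<^bsub>C\<^esub>k\<in>?K. Poly_Mapping.lookup u k \<odot>\<^bsub>C\<^esub> \<phi> k)"
    using \<phi>_K by (intro C.finsum_addf) auto
  also have "\<dots> = linear_extension C \<phi> t \<oplus>\<^bsub>C\<^esub> linear_extension C \<phi> u"
    using K linear_extension_eq_finsum[of ?K t] linear_extension_eq_finsum[of ?K u] by simp
  finally show "linear_extension C \<phi> (t \<oplus>\<^bsub>monoid_algebra G\<^esub> u) =
      linear_extension C \<phi> t \<oplus>\<^bsub>C\<^esub> linear_extension C \<phi> u"
    by (simp add: monoid_algebra_simps)
qed

lemma linear_extension_single:
  assumes "k \<in> carrier G"
  shows "linear_extension C \<phi> (Poly_Mapping.single k c) = c \<odot>\<^bsub>C\<^esub> \<phi> k"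
  using assms \<phi> C.add.finprod_singleton_swap[of k "{k}" "\<lambda>k. c \<odot>\<^bsub>C\<^esub> \<phi> k"]
  by (subst linear_extension_eq_finsum[of "{k}"]) (auto simp: in_keys_iff lookup_single when_def split: if_splits)

text \<open>Both sides of the product law are linear in each factor, so the comparison on the basis
  is applied twice: with a basis element as left factor and u varying, then with u fixed and t
  varying.\<close>

lemma linear_extension_algebra_hom:
  assumes G: "monoid G" and one: "\<phi> \<one>\<^bsub>G\<^esub> = \<one>\<^bsub>C\<^esub>"
    and mult: "\<And>k l. \<lbrakk>k \<in> carrier G; l \<in> carrier G\<rbrakk> \<Longrightarrow> \<phi> (k \<otimes>\<^bsub>G\<^esub> l) = \<phi> k \<otimes>\<^bsub>C\<^esub> \<phi> l"
  shows "linear_extension C \<phi> \<in> algebra_hom (monoid_algebra G) C"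
proof (rule algebra_homI)
  interpret G: monoid G by fact
  let ?M = "monoid_algebra G"
  interpret M: complex_algebra ?M by (rule complex_algebra_monoid_algebra) fact
  note L = linear_extension_linear
  show "linear_extension C \<phi> \<one>\<^bsub>?M\<^esub> = \<one>\<^bsub>C\<^esub>"
    using one by (simp add: monoid_algebra_simps linear_extension_single)
  fix t u assume t: "t \<in> carrier ?M" and u: "u \<in> carrier ?M"
  have single: "linear_extension C \<phi> (Poly_Mapping.single k 1 \<otimes>\<^bsub>?M\<^esub> u) =
    linear_extension C \<phi> (Poly_Mapping.single k 1) \<otimes>\<^bsub>C\<^esub> linear_extension C \<phi> u"
    if k: "k \<in> carrier G" for k
  proof (rule linear_maps_monoid_algebra_eqI[OF G C _ _ _ u])
    have "Poly_Mapping.single k 1 \<in> carrier ?M" using k by (rule single_in_monoid_algebra)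
    then show "(\<lambda>u. linear_extension C \<phi> (Poly_Mapping.single k 1 \<otimes>\<^bsub>?M\<^esub> u)) \<in> linear_maps ?M C"
      "(\<lambda>u. linear_extension C \<phi> (Poly_Mapping.single k 1) \<otimes>\<^bsub>C\<^esub> linear_extension C \<phi> u)
        \<in> linear_maps ?M C"
      by (auto intro: linear_maps_comp[OF M.linear_mult_left L]
        linear_maps_comp[OF L C.linear_mult_left] linear_mapsD(1)[OF L])
  qed (simp add: monoid_algebra_mult_single linear_extension_single mult k \<phi>)
  show "linear_extension C \<phi> (t \<otimes>\<^bsub>?M\<^esub> u) = linear_extension C \<phi> t \<otimes>\<^bsub>C\<^esub> linear_extension C \<phi> u"
  proof (rule linear_maps_monoid_algebra_eqI[OF G C _ _ _ t])
    show "(\<lambda>t. linear_extension C \<phi> (t \<otimes>\<^bsub>?M\<^esub> u)) \<in> linear_maps ?M C"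
      "(\<lambda>t. linear_extension C \<phi> t \<otimes>\<^bsub>C\<^esub> linear_extension C \<phi> u) \<in> linear_maps ?M C"
      using u by (auto intro: linear_maps_comp[OF M.linear_mult_right L]
        linear_maps_comp[OF L C.linear_mult_right] linear_mapsD(1)[OF L])
  qed (rule single)
qed (rule linear_extension_linear)

end

section \<open>Submodules, linear spans and quotient algebras\<close>

text \<open>This is how statements about a linear span are proved below: if a linear map sends the
  spanning set into N, then the preimage of N is a submodule containing that set, hence contains its
  span.\<close>

lemma submodule_vimage:
  assumes "complex_algebra A" "complex_algebra B" "f \<in> linear_maps A B"
    "submodule N complex_alg B"
  shows "submodule {x \<in> carrier A. f x \<in> N} complex_alg A"
proof -
  interpret A: complex_algebra A by fact
  interpret B: complex_algebra B by fact
  note N = B.submoduleE[OF assms(4)]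
  note f = linear_mapsD[OF assms(3)]
  interpret N: submodule N complex_alg B by fact
  have "\<zero>\<^bsub>B\<^esub> \<in> N"
    using N.one_closed by simp
  then show ?thesis
    using N f linear_map_zero[OF assms(1-3)] linear_map_a_inv[OF assms(1-3)]
    by (intro A.submoduleI) auto
qed

lemma submodule_zero:
  assumes "complex_algebra A"
  shows "submodule {\<zero>\<^bsub>A\<^esub>} complex_alg A"
proof -
  interpret A: complex_algebra A by fact
  show ?thesis
    using A.smult_r_null by (intro A.submoduleI) auto
qed

lemma subset_linear_span: "X \<subseteq> linear_span A X"
  by (auto simp: linear_span_def)

lemma linear_span_minimal: "submodule N complex_alg A \<Longrightarrow> X \<subseteq> N \<Longrightarrow> linear_span A X \<subseteq> N"
  by (auto simp: linear_span_def)

text \<open>The assumption on X makes the whole carrier one of the intersected submodules; this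
  keeps the span inside the carrier.\<close>

lemma submodule_linear_span:
  assumes "complex_algebra A" "X \<subseteq> carrier A"
  shows "submodule (linear_span A X) complex_alg A"
proof -
  interpret A: complex_algebra A by fact
  have zero: "\<zero>\<^bsub>A\<^esub> \<in> N" if "submodule N complex_alg A" for N
  proof -
    interpret N: submodule N complex_alg A by (rule that)
    show ?thesis using N.one_closed by simp
  qed
  show ?thesis
    using A.submoduleE A.carrier_is_submodule assms(2) zero
    by (intro A.submoduleI) (auto simp: linear_span_def)
qed

text \<open>A quotient algebra has the ring operations of the factor ring, but in a record with a
  scalar multiplication added. The ring laws are carried over to this other record.\<close>

lemma ring_cong:
  assumes "ring R" "carrier S = carrier R" "mult S = mult R" "one S = one R"
    "zero S = zero R" "add S = add R"
  shows "ring S"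
proof -
  interpret ring R by fact
  show ?thesis
  proof (rule ringI)
    show "abelian_group S"
      by (rule abelian_groupI) (auto simp: assms(2-) a_ac intro!: l_neg bexI[of _ "\<ominus>\<^bsub>R\<^esub> x" for x])
    show "Group.monoid S"
      by (rule monoidI) (auto simp: assms(2-) m_assoc)
  qed (auto simp: assms(2-) l_distr r_distr)
qed

section \<open>Quotients of algebras by two-sided ideals, and the maps they induce\<close>

context
  fixes A :: "(complex, 'a) module" and I :: "'a set"
  assumes A: "complex_algebra A" and I: "ideal I A"
begin

interpretation A: complex_algebra A by (rule A)
interpretation I: ideal I A by (rule I)

lemma quotient_algebra_carrier:
  "carrier (quotient_algebra A I) = (\<lambda>x. I +>\<^bsub>A\<^esub> x) ` carrier A"
  by (auto simp: quotient_algebra_def FactRing_def A_RCOSETS_def' a_r_coset_def)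

text \<open>An ideal in the ring sense is automatically a subspace, since c x = (c 1) x and the
  ideal absorbs c 1.\<close>

lemma ideal_smult_closed: "x \<in> I \<Longrightarrow> c \<odot>\<^bsub>A\<^esub> x \<in> I"
  using I.I_l_closed[of x "c \<odot>\<^bsub>A\<^esub> \<one>\<^bsub>A\<^esub>"] I.a_Hcarr[of x]
  by (simp add: A.smult_mult_left)

text \<open>The scalar multiple of a coset is defined as a union over all its representatives. Since
  c I lies in I, the representatives all give the same coset, and as the original coset is nonempty
  the union is that single coset.\<close>

lemma quotient_algebra_smult:
  assumes x: "x \<in> carrier A"
  shows "c \<odot>\<^bsub>quotient_algebra A I\<^esub> (I +>\<^bsub>A\<^esub> x) = I +>\<^bsub>A\<^esub> (c \<odot>\<^bsub>A\<^esub> x)"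
proof -
  have "I +>\<^bsub>A\<^esub> (c \<odot>\<^bsub>A\<^esub> y) = I +>\<^bsub>A\<^esub> (c \<odot>\<^bsub>A\<^esub> x)" if y: "y \<in> I +>\<^bsub>A\<^esub> x" for y
  proof -
    obtain i where i: "i \<in> I" "y = i \<oplus>\<^bsub>A\<^esub> x"
      using y by (auto simp: a_r_coset_def')
    then have "c \<odot>\<^bsub>A\<^esub> y = c \<odot>\<^bsub>A\<^esub> i \<oplus>\<^bsub>A\<^esub> c \<odot>\<^bsub>A\<^esub> x"
      using x I.a_Hcarr A.smult_r_distr by simp
    then have "c \<odot>\<^bsub>A\<^esub> y \<in> I +>\<^bsub>A\<^esub> (c \<odot>\<^bsub>A\<^esub> x)"
      using ideal_smult_closed[OF i(1)] by (auto simp: a_r_coset_def')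
    then show ?thesis
      using x I.a_repr_independence' by (metis A.smult_closed UNIV_I complex_alg_simps(1))
  qed
  moreover have "x \<in> I +>\<^bsub>A\<^esub> x"
    using x by (rule I.a_rcos_self)
  ultimately show ?thesis
    unfolding quotient_algebra_def module.simps by (intro UN_constant_eq ballI)
qed

lemma quotient_algebra_simps:
  "\<lbrakk>x \<in> carrier A; y \<in> carrier A\<rbrakk> \<Longrightarrow>
    (I +>\<^bsub>A\<^esub> x) \<otimes>\<^bsub>quotient_algebra A I\<^esub> (I +>\<^bsub>A\<^esub> y) = I +>\<^bsub>A\<^esub> (x \<otimes>\<^bsub>A\<^esub> y)"
  "\<lbrakk>x \<in> carrier A; y \<in> carrier A\<rbrakk> \<Longrightarrow>
    (I +>\<^bsub>A\<^esub> x) \<oplus>\<^bsub>quotient_algebra A I\<^esub> (I +>\<^bsub>A\<^esub> y) = I +>\<^bsub>A\<^esub> (x \<oplus>\<^bsub>A\<^esub> y)"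
  "\<one>\<^bsub>quotient_algebra A I\<^esub> = I +>\<^bsub>A\<^esub> \<one>\<^bsub>A\<^esub>"
  "\<zero>\<^bsub>quotient_algebra A I\<^esub> = I"
  by (simp_all add: quotient_algebra_def FactRing_def I.rcoset_mult_add I.a_rcos_sum)

lemma complex_algebra_quotient_algebra: "complex_algebra (quotient_algebra A I)"
proof (rule complex_algebraI)
  show "ring (quotient_algebra A I)"
    using I.quotient_is_ring by (rule ring_cong) (simp_all add: quotient_algebra_def)
qed (use A.smult_l_distr A.smult_r_distr A.smult_assoc1 in
    \<open>auto simp: quotient_algebra_carrier quotient_algebra_smult quotient_algebra_simps
      A.smult_mult_left A.smult_mult_right\<close>)

lemma coset_algebra_hom: "(\<lambda>x. I +>\<^bsub>A\<^esub> x) \<in> algebra_hom A (quotient_algebra A I)"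
  by (intro algebra_homI linear_mapsI)
    (auto simp: quotient_algebra_carrier quotient_algebra_smult quotient_algebra_simps)

context
  fixes B :: "(complex, 'b) module" and f :: "'a \<Rightarrow> 'b"
  assumes B: "complex_algebra B" and f: "f \<in> linear_maps A B"
    and ker: "\<And>x. x \<in> I \<Longrightarrow> f x = \<zero>\<^bsub>B\<^esub>"
begin

interpretation B: complex_algebra B by (rule B)

text \<open>Vanishing on I makes f constant on each coset, and a coset contains its representative.
  So the image is a singleton and \<open>the_elem\<close> reads off the induced value.\<close>

lemma the_elem_image_coset:
  assumes "x \<in> carrier A"
  shows "the_elem (f ` (I +>\<^bsub>A\<^esub> x)) = f x"
proof -
  have "f y = f x" if "y \<in> I +>\<^bsub>A\<^esub> x" for y
    using that ker assms linear_mapsD[OF f] I.a_Hcarr by (auto simp: a_r_coset_def')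
  moreover have "I +>\<^bsub>A\<^esub> x \<noteq> {}"
    using I.a_rcos_self[OF assms] by auto
  ultimately show ?thesis
    by (intro the_elem_image_unique)
qed

lemma quotient_lift_linear: "(\<lambda>X. the_elem (f ` X)) \<in> linear_maps (quotient_algebra A I) B"
  by (rule linear_mapsI)
    (auto simp: quotient_algebra_carrier quotient_algebra_smult quotient_algebra_simps
      the_elem_image_coset linear_mapsD[OF f])

lemma quotient_lift_algebra_hom:
  assumes "f \<in> algebra_hom A B"
  shows "(\<lambda>X. the_elem (f ` X)) \<in> algebra_hom (quotient_algebra A I) B"
  by (rule algebra_homI)
    (auto simp: quotient_algebra_carrier quotient_algebra_simps the_elem_image_coset
      algebra_homD[OF assms] quotient_lift_linear)

end

end

section \<open>Tensor products\<close>

definition bilinear_maps ::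
    "(complex, 'a) module \<Rightarrow> (complex, 'b) module \<Rightarrow> (complex, 'c) module \<Rightarrow> ('a \<Rightarrow> 'b \<Rightarrow> 'c) set"
  where "bilinear_maps A B C = {\<beta>. (\<forall>x\<in>carrier A. \<beta> x \<in> linear_maps B C) \<and>
    (\<forall>y\<in>carrier B. (\<lambda>x. \<beta> x y) \<in> linear_maps A C)}"

lemma bilinear_mapsI:
  assumes "\<And>x. x \<in> carrier A \<Longrightarrow> \<beta> x \<in> linear_maps B C"
    and "\<And>y. y \<in> carrier B \<Longrightarrow> (\<lambda>x. \<beta> x y) \<in> linear_maps A C"
  shows "\<beta> \<in> bilinear_maps A B C"
  using assms by (simp add: bilinear_maps_def)

lemma bilinear_mapsD:
  assumes "\<beta> \<in> bilinear_maps A B C"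
  shows "x \<in> carrier A \<Longrightarrow> \<beta> x \<in> linear_maps B C"
    and "y \<in> carrier B \<Longrightarrow> (\<lambda>x. \<beta> x y) \<in> linear_maps A C"
  using assms by (simp_all add: bilinear_maps_def)

lemma bilinearity_relations_intros:
  "\<lbrakk>x \<in> carrier A; x' \<in> carrier A; y \<in> carrier B\<rbrakk> \<Longrightarrow>
    Poly_Mapping.single (x \<oplus>\<^bsub>A\<^esub> x', y) 1 - Poly_Mapping.single (x, y) 1
      - Poly_Mapping.single (x', y) 1 \<in> bilinearity_relations A B"
  "\<lbrakk>x \<in> carrier A; y \<in> carrier B; y' \<in> carrier B\<rbrakk> \<Longrightarrow>
    Poly_Mapping.single (x, y \<oplus>\<^bsub>B\<^esub> y') 1 - Poly_Mapping.single (x, y) 1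
      - Poly_Mapping.single (x, y') 1 \<in> bilinearity_relations A B"
  "\<lbrakk>x \<in> carrier A; y \<in> carrier B\<rbrakk> \<Longrightarrow>
    Poly_Mapping.single (c \<odot>\<^bsub>A\<^esub> x, y) 1 - Poly_Mapping.single (x, y) c \<in> bilinearity_relations A B"
  "\<lbrakk>x \<in> carrier A; y \<in> carrier B\<rbrakk> \<Longrightarrow>
    Poly_Mapping.single (x, c \<odot>\<^bsub>B\<^esub> y) 1 - Poly_Mapping.single (x, y) c \<in> bilinearity_relations A B"
  unfolding bilinearity_relations_def by blast+

lemma bilinearity_relations_cases [consumes 1, case_names add_left add_right smult_left smult_right]:
  assumes "r \<in> bilinearity_relations A B"
  obtains
    x x' y where
      "r = Poly_Mapping.single (x \<oplus>\<^bsub>A\<^esub> x', y) 1 - Poly_Mapping.single (x, y) 1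
        - Poly_Mapping.single (x', y) 1"
      "x \<in> carrier A" "x' \<in> carrier A" "y \<in> carrier B"
  | x y y' where
      "r = Poly_Mapping.single (x, y \<oplus>\<^bsub>B\<^esub> y') 1 - Poly_Mapping.single (x, y) 1
        - Poly_Mapping.single (x, y') 1"
      "x \<in> carrier A" "y \<in> carrier B" "y' \<in> carrier B"
  | c x y where
      "r = Poly_Mapping.single (c \<odot>\<^bsub>A\<^esub> x, y) 1 - Poly_Mapping.single (x, y) c"
      "x \<in> carrier A" "y \<in> carrier B"
  | c x y where
      "r = Poly_Mapping.single (x, c \<odot>\<^bsub>B\<^esub> y) 1 - Poly_Mapping.single (x, y) c"
      "x \<in> carrier A" "y \<in> carrier B"
  using assms unfolding bilinearity_relations_def
  by (elim UnE CollectE exE conjE)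
    (rule that(1), assumption+ | rule that(2), assumption+ | rule that(3), assumption+
      | rule that(4), assumption+)+

text \<open>A defining relation evaluates to a difference of the shape (x + y) - x - y or x - x,
  both for the bilinearity relations and for the Heisenberg relations. These two rules reduce it to
  zero.\<close>

lemma (in abelian_group) add_minus_cancel:
  "\<lbrakk>x \<in> carrier G; y \<in> carrier G\<rbrakk> \<Longrightarrow> x \<oplus> y \<ominus> x = y"
  "x \<in> carrier G \<Longrightarrow> x \<ominus> x = \<zero>"
  by (simp_all add: minus_eq a_comm[of x y] a_assoc r_neg)

lemma tensor_lift_eq:
  "tensor_lift C \<beta> X = the_elem (linear_extension C (\<lambda>k. \<beta> (fst k) (snd k)) ` X)"
  by (simp add: tensor_lift_def linear_extension_def [abs_def])

section \<open>The tensor product of two algebras as an algebra\<close>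

context
  fixes A :: "(complex, 'a) module" and B :: "(complex, 'b) module"
  assumes A: "complex_algebra A" and B: "complex_algebra B"
begin

interpretation A: complex_algebra A by (rule A)
interpretation B: complex_algebra B by (rule B)

private abbreviation (input) "M \<equiv> monoid_algebra (A \<times>\<times> B)"
private abbreviation (input) "K \<equiv> tensor_kernel A B"
private abbreviation (input) "T \<equiv> tensor_algebra A B"

lemma monoid_DirProd_algebras: "monoid (A \<times>\<times> B)"
  by (intro DirProd_monoid A.is_monoid B.is_monoid)

lemma complex_algebra_tensor_representatives: "complex_algebra M"
  by (rule complex_algebra_monoid_algebra) (rule monoid_DirProd_algebras)

interpretation M: complex_algebra M by (rule complex_algebra_tensor_representatives)

lemma single_in_tensor_representatives:
  "x \<in> carrier A \<Longrightarrow> y \<in> carrier B \<Longrightarrow> Poly_Mapping.single (x, y) c \<in> carrier M"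
  by (simp add: single_in_monoid_algebra DirProd_def)

lemma bilinearity_relations_subset: "bilinearity_relations A B \<subseteq> carrier M"
  by (auto elim!: bilinearity_relations_cases
    intro!: monoid_algebra_closed(2) single_in_tensor_representatives)

text \<open>Multiplication by a pair (a, b) acts componentwise on pairs. By distributivity and
  compatibility with scalars, it turns a relation for x, y into the relation of the same family for
  a x, b y, or for x a, y b on the other side.\<close>

lemma bilinearity_relations_mult:
  assumes r: "r \<in> bilinearity_relations A B" and k: "k \<in> carrier (A \<times>\<times> B)"
  shows "Poly_Mapping.single k 1 \<otimes>\<^bsub>M\<^esub> r \<in> bilinearity_relations A B"
    and "r \<otimes>\<^bsub>M\<^esub> Poly_Mapping.single k 1 \<in> bilinearity_relations A B"
proof -
  obtain a b where ab: "k = (a, b)" "a \<in> carrier A" "b \<in> carrier B"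
    using k by (auto simp: DirProd_def)
  note simps = ab monoid_algebra_mult_minus_left monoid_algebra_mult_minus_right
    monoid_algebra_mult_single A.l_distr A.r_distr B.l_distr B.r_distr
    A.smult_mult_left A.smult_mult_right B.smult_mult_left B.smult_mult_right
  from r have "Poly_Mapping.single k 1 \<otimes>\<^bsub>M\<^esub> r \<in> bilinearity_relations A B \<and>
    r \<otimes>\<^bsub>M\<^esub> Poly_Mapping.single k 1 \<in> bilinearity_relations A B"
    by (cases rule: bilinearity_relations_cases)
      (simp_all add: simps bilinearity_relations_intros)
  then show "Poly_Mapping.single k 1 \<otimes>\<^bsub>M\<^esub> r \<in> bilinearity_relations A B"
    "r \<otimes>\<^bsub>M\<^esub> Poly_Mapping.single k 1 \<in> bilinearity_relations A B" by auto
qed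

lemma submodule_tensor_kernel: "submodule K complex_alg M"
  unfolding tensor_kernel_def
  by (rule submodule_linear_span[OF complex_algebra_tensor_representatives
    bilinearity_relations_subset])

lemma tensor_kernel_vimage:
  assumes f: "f \<in> linear_maps M M"
    and rel: "\<And>r. r \<in> bilinearity_relations A B \<Longrightarrow> f r \<in> bilinearity_relations A B"
    and t: "t \<in> K"
  shows "f t \<in> K"
proof -
  have "K \<subseteq> {t \<in> carrier M. f t \<in> K}"
    using rel bilinearity_relations_subset subset_linear_span[of "bilinearity_relations A B" M]
    by (subst (1) tensor_kernel_def, intro linear_span_minimal submodule_vimage[OF _ _ f]
      complex_algebra_tensor_representatives submodule_tensor_kernel)
     (auto simp: tensor_kernel_def)
  with t show ?thesis by auto
qed

text \<open>The kernel is only a linear span by definition. It absorbs multiplication by basis pairs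
  because these permute the relations among themselves, and general factors are sums of scaled
  pairs. This is what makes the product on the quotient well defined.\<close>

lemma ideal_tensor_kernel: "ideal K M"
proof (rule idealI)
  interpret K: submodule K complex_alg M by (rule submodule_tensor_kernel)
  show "ring M" ..
  show "subgroup K (add_monoid M)" ..
  fix t u assume t: "t \<in> K" and u: "u \<in> carrier M"
  have tM: "t \<in> carrier M"
    using t M.submoduleE(1)[OF submodule_tensor_kernel] by auto
  have zero: "0 \<in> K"
    using K.one_closed by (simp add: monoid_algebra_simps)
  have add: "v + w \<in> K" if "v \<in> K" "w \<in> K" for v w
    using K.m_closed[OF that] by (simp add: monoid_algebra_simps)
  have single: "Poly_Mapping.single k c \<otimes>\<^bsub>M\<^esub> t \<in> K \<and> t \<otimes>\<^bsub>M\<^esub> Poly_Mapping.single k c \<in> K"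
    if k: "k \<in> carrier (A \<times>\<times> B)" for k c
  proof -
    have k1: "Poly_Mapping.single k 1 \<in> carrier M"
      using k by (rule single_in_monoid_algebra)
    have "Poly_Mapping.single k 1 \<otimes>\<^bsub>M\<^esub> t \<in> K" "t \<otimes>\<^bsub>M\<^esub> Poly_Mapping.single k 1 \<in> K"
      by (rule tensor_kernel_vimage[OF M.linear_mult_left[OF k1] bilinearity_relations_mult(1)[OF _ k] t],
        assumption,
        rule tensor_kernel_vimage[OF M.linear_mult_right[OF k1] bilinearity_relations_mult(2)[OF _ k] t])
    \<comment> \<open>Stability of the relations is known only for coefficient 1: multiplying by a
      pair with coefficient c yields a scalar multiple of a relation, which lies in the span but
      need not be a relation itself. Hence the scalar is split off.\<close>
    moreover have "Poly_Mapping.single k c = c \<odot>\<^bsub>M\<^esub> Poly_Mapping.single k 1"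
      by (simp add: monoid_algebra_simps)
    ultimately show ?thesis
      using k1 tM by (simp add: M.smult_mult_left M.smult_mult_right)
  qed
  from u show "u \<otimes>\<^bsub>M\<^esub> t \<in> K"
    by (induction rule: monoid_algebra_induct)
      (auto simp: monoid_algebra_mult_add_left zero single intro: add)
  from u show "t \<otimes>\<^bsub>M\<^esub> u \<in> K"
    by (induction rule: monoid_algebra_induct)
      (auto simp: monoid_algebra_mult_add_right zero single intro: add)
qed

interpretation K: ideal K M by (rule ideal_tensor_kernel)

lemma complex_algebra_tensor_algebra: "complex_algebra T"
  unfolding tensor_algebra_def
  by (rule complex_algebra_quotient_algebra[OF complex_algebra_tensor_representatives
    ideal_tensor_kernel])

interpretation T: complex_algebra T by (rule complex_algebra_tensor_algebra)

private lemma coset_hom: "(\<lambda>t. K +>\<^bsub>M\<^esub> t) \<in> algebra_hom M T"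
  unfolding tensor_algebra_def
  by (rule coset_algebra_hom[OF complex_algebra_tensor_representatives ideal_tensor_kernel])

lemma pure_tensor_closed [simp]:
  "x \<in> carrier A \<Longrightarrow> y \<in> carrier B \<Longrightarrow> pure_tensor A B x y \<in> carrier T"
  using algebra_homD(2)[OF coset_hom] single_in_tensor_representatives
  by (simp add: pure_tensor_def)

lemma pure_tensor_mult:
  assumes "x \<in> carrier A" "y \<in> carrier B" "x' \<in> carrier A" "y' \<in> carrier B"
  shows "pure_tensor A B x y \<otimes>\<^bsub>T\<^esub> pure_tensor A B x' y' =
    pure_tensor A B (x \<otimes>\<^bsub>A\<^esub> x') (y \<otimes>\<^bsub>B\<^esub> y')"
  using assms algebra_homD(6)[OF coset_hom, symmetric] single_in_tensor_representatives
  by (simp add: pure_tensor_def monoid_algebra_mult_single)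

lemma pure_tensor_one: "pure_tensor A B \<one>\<^bsub>A\<^esub> \<one>\<^bsub>B\<^esub> = \<one>\<^bsub>T\<^esub>"
  using algebra_homD(5)[OF coset_hom] by (simp add: pure_tensor_def monoid_algebra_simps DirProd_def)

lemma coset_eq_if_relation:
  assumes "t \<in> carrier M" "u \<in> carrier M" "t - u \<in> bilinearity_relations A B"
  shows "K +>\<^bsub>M\<^esub> t = K +>\<^bsub>M\<^esub> u"
proof -
  have "t \<ominus>\<^bsub>M\<^esub> u \<in> K"
    using assms subset_linear_span[of "bilinearity_relations A B" M]
    by (auto simp: monoid_algebra_a_minus[OF monoid_DirProd_algebras] tensor_kernel_def)
  then show ?thesis
    using assms(1,2) M.quotient_eq_iff_same_a_r_cos[OF ideal_tensor_kernel] by simp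
qed

lemma pure_tensor_bilinear: "pure_tensor A B \<in> bilinear_maps A B T"
proof (intro bilinear_mapsI linear_mapsI)
  fix x y c assume xy: "x \<in> carrier A" "y \<in> carrier B"
  note single = single_in_tensor_representatives
  \<comment> \<open>The scalar relations carry c as the coefficient of the pair (x, y), so the
    scalar multiple is brought to this form before it is matched with a relation.\<close>
  have smult: "c \<odot>\<^bsub>T\<^esub> pure_tensor A B x y = K +>\<^bsub>M\<^esub> Poly_Mapping.single (x, y) c"
    using algebra_homD(4)[OF coset_hom single[OF xy, of 1], of c]
    by (simp add: pure_tensor_def monoid_algebra_simps)
  have add: "pure_tensor A B x y \<oplus>\<^bsub>T\<^esub> pure_tensor A B x' y' =
      K +>\<^bsub>M\<^esub> (Poly_Mapping.single (x, y) 1 + Poly_Mapping.single (x', y') 1)"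
    if "x' \<in> carrier A" "y' \<in> carrier B" for x' y'
    using algebra_homD(3)[OF coset_hom single[OF xy, of 1] single[OF that, of 1]]
    by (simp add: pure_tensor_def monoid_algebra_simps)
  show "pure_tensor A B x y \<in> carrier T" "pure_tensor A B x y \<in> carrier T"
    using xy by auto
  show "pure_tensor A B (c \<odot>\<^bsub>A\<^esub> x) y = c \<odot>\<^bsub>T\<^esub> pure_tensor A B x y"
    "pure_tensor A B x (c \<odot>\<^bsub>B\<^esub> y) = c \<odot>\<^bsub>T\<^esub> pure_tensor A B x y"
    unfolding smult unfolding pure_tensor_def using xy
    by (intro coset_eq_if_relation; auto intro!: single simp: bilinearity_relations_intros)+
  show "pure_tensor A B (x \<oplus>\<^bsub>A\<^esub> x') y = pure_tensor A B x y \<oplus>\<^bsub>T\<^esub> pure_tensor A B x' y"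
    if x': "x' \<in> carrier A" for x'
    unfolding add[OF x' xy(2)] unfolding pure_tensor_def
  proof (rule coset_eq_if_relation)
    show "Poly_Mapping.single (x \<oplus>\<^bsub>A\<^esub> x', y) 1 -
        (Poly_Mapping.single (x, y) 1 + Poly_Mapping.single (x', y) 1)
      \<in> bilinearity_relations A B"
      using xy x' by (auto simp: bilinearity_relations_intros diff_diff_eq[symmetric])
  qed (use xy x' in \<open>auto intro!: single monoid_algebra_closed(1)\<close>)
  show "pure_tensor A B x (y \<oplus>\<^bsub>B\<^esub> y') = pure_tensor A B x y \<oplus>\<^bsub>T\<^esub> pure_tensor A B x y'"
    if y': "y' \<in> carrier B" for y'
    unfolding add[OF xy(1) y'] unfolding pure_tensor_def
  proof (rule coset_eq_if_relation)
    show "Poly_Mapping.single (x, y \<oplus>\<^bsub>B\<^esub> y') 1 -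
        (Poly_Mapping.single (x, y) 1 + Poly_Mapping.single (x, y') 1)
      \<in> bilinearity_relations A B"
      using xy y' by (auto simp: bilinearity_relations_intros diff_diff_eq[symmetric])
  qed (use xy y' in \<open>auto intro!: single monoid_algebra_closed(1)\<close>)
qed

text \<open>Each element is the coset of a linear combination of pairs, and the coset of a pair with
  coefficient c is c times a pure tensor.\<close>

lemma tensor_induct [consumes 1, case_names pure add smult]:
  assumes "t \<in> carrier T"
    and pure: "\<And>x y. \<lbrakk>x \<in> carrier A; y \<in> carrier B\<rbrakk> \<Longrightarrow> \<Phi> (pure_tensor A B x y)"
    and add: "\<And>t u. \<lbrakk>t \<in> carrier T; u \<in> carrier T; \<Phi> t; \<Phi> u\<rbrakk> \<Longrightarrow> \<Phi> (t \<oplus>\<^bsub>T\<^esub> u)"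
    and smult: "\<And>c t. \<lbrakk>t \<in> carrier T; \<Phi> t\<rbrakk> \<Longrightarrow> \<Phi> (c \<odot>\<^bsub>T\<^esub> t)"
  shows "\<Phi> t"
proof -
  have single: "\<Phi> (K +>\<^bsub>M\<^esub> Poly_Mapping.single k c)" if k: "k \<in> carrier (A \<times>\<times> B)" for k c
  proof -
    obtain x y where xy: "k = (x, y)" "x \<in> carrier A" "y \<in> carrier B"
      using k by (auto simp: DirProd_def)
    then have "K +>\<^bsub>M\<^esub> Poly_Mapping.single k c = c \<odot>\<^bsub>T\<^esub> pure_tensor A B x y"
      using algebra_homD(4)[OF coset_hom single_in_tensor_representatives[OF xy(2,3), of 1], of c]
      by (simp add: pure_tensor_def monoid_algebra_simps)
    with pure[OF xy(2,3)] smult xy show ?thesis by simp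
  qed
  have "\<Phi> (K +>\<^bsub>M\<^esub> u)" if "u \<in> carrier M" for u
    using that
  proof (induction rule: monoid_algebra_induct)
    case zero
    \<comment> \<open>The zero representative is a pair with coefficient 0; any pair from the
      carriers would do.\<close>
    show ?case using single[of "(\<zero>\<^bsub>A\<^esub>, \<zero>\<^bsub>B\<^esub>)" 0] by (simp add: DirProd_def)
  next
    case (add u v)
    then show ?case
      using assms(3) algebra_homD(2,3)[OF coset_hom] by (simp add: monoid_algebra_simps(4))
  qed (rule single)
  with assms(1) show ?thesis
    by (auto simp: tensor_algebra_def quotient_algebra_carrier[OF
      complex_algebra_tensor_representatives ideal_tensor_kernel])
qed

lemma linear_maps_tensor_eqI:
  assumes f: "f \<in> linear_maps T C" and g: "g \<in> linear_maps T C"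
    and eq: "\<And>x y. \<lbrakk>x \<in> carrier A; y \<in> carrier B\<rbrakk> \<Longrightarrow>
      f (pure_tensor A B x y) = g (pure_tensor A B x y)"
    and "t \<in> carrier T"
  shows "f t = g t"
  using assms(4)
  by (induction rule: tensor_induct) (auto simp: linear_mapsD[OF f] linear_mapsD[OF g] eq)

section \<open>The universal property of the tensor product\<close>

context
  fixes C :: "(complex, 'c) module" and \<beta> :: "'a \<Rightarrow> 'b \<Rightarrow> 'c"
  assumes C: "complex_algebra C" and \<beta>: "\<beta> \<in> bilinear_maps A B C"
begin

interpretation C: complex_algebra C by (rule C)

private abbreviation (input) "L \<equiv> linear_extension C (\<lambda>k. \<beta> (fst k) (snd k))"

private lemma bilinear_closed:
  "k \<in> carrier (A \<times>\<times> B) \<Longrightarrow> \<beta> (fst k) (snd k) \<in> carrier C"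
  using linear_mapsD(1)[OF bilinear_mapsD(1)[OF \<beta>]] by (auto simp: DirProd_def)

private lemma L_linear: "L \<in> linear_maps M C"
  using C bilinear_closed by (rule linear_extension_linear)

private lemma L_single:
  "x \<in> carrier A \<Longrightarrow> y \<in> carrier B \<Longrightarrow> L (Poly_Mapping.single (x, y) c) = c \<odot>\<^bsub>C\<^esub> \<beta> x y"
  using linear_extension_single[OF C, where G = "A \<times>\<times> B" and k = "(x, y)" and c = c
      and \<phi> = "\<lambda>k. \<beta> (fst k) (snd k)"] bilinear_closed
  by (simp add: DirProd_def)

text \<open>Bilinearity of \<beta> says exactly that the linear extension kills the four families of
  relations. Its zero set is a submodule, so it contains their span.\<close>

private lemma L_kernel:
  assumes "t \<in> K"
  shows "L t = \<zero>\<^bsub>C\<^esub>"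
proof -
  note closed = linear_mapsD(1)[OF bilinear_mapsD(1)[OF \<beta>]]
  note simps = L_single closed linear_mapsD(2,3)[OF bilinear_mapsD(1)[OF \<beta>]]
    linear_mapsD(2,3)[OF bilinear_mapsD(2)[OF \<beta>]]
  have minus: "L (t - u) = L t \<ominus>\<^bsub>C\<^esub> L u" if "t \<in> carrier M" "u \<in> carrier M" for t u
    using linear_map_minus[OF complex_algebra_tensor_representatives C L_linear that] that
    by (simp add: monoid_algebra_a_minus[OF monoid_DirProd_algebras])
  have "L r = \<zero>\<^bsub>C\<^esub>" if "r \<in> bilinearity_relations A B" for r
    using that
    by (cases rule: bilinearity_relations_cases)
      (simp_all add: minus simps C.add_minus_cancel single_in_tensor_representatives monoid_algebra_closed(2))
  then have "K \<subseteq> {t \<in> carrier M. L t \<in> {\<zero>\<^bsub>C\<^esub>}}"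
    using bilinearity_relations_subset
    unfolding tensor_kernel_def
    by (intro linear_span_minimal submodule_vimage[OF _ C L_linear] submodule_zero C
      complex_algebra_tensor_representatives) auto
  with assms show ?thesis by auto
qed

text \<open>\<open>tensor_lift\<close> is the map induced on cosets by the linear extension of
  \<beta>, and that extension vanishes on the kernel.\<close>

lemma tensor_lift_linear: "tensor_lift C \<beta> \<in> linear_maps T C"
  unfolding tensor_algebra_def tensor_lift_eq [abs_def]
  using complex_algebra_tensor_representatives ideal_tensor_kernel C L_linear L_kernel
  by (rule quotient_lift_linear)

lemma tensor_lift_pure:
  assumes "x \<in> carrier A" "y \<in> carrier B"
  shows "tensor_lift C \<beta> (pure_tensor A B x y) = \<beta> x y"
  using the_elem_image_coset[OF complex_algebra_tensor_representatives ideal_tensor_kernel C L_linear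
      L_kernel single_in_tensor_representatives[OF assms]] L_single[OF assms, of 1]
    linear_mapsD(1)[OF bilinear_mapsD(1)[OF \<beta>]] assms
  by (simp add: tensor_lift_eq pure_tensor_def)

lemma tensor_lift_algebra_hom:
  assumes one: "\<beta> \<one>\<^bsub>A\<^esub> \<one>\<^bsub>B\<^esub> = \<one>\<^bsub>C\<^esub>"
    and mult: "\<And>x y x' y'. \<lbrakk>x \<in> carrier A; y \<in> carrier B; x' \<in> carrier A; y' \<in> carrier B\<rbrakk> \<Longrightarrow>
      \<beta> (x \<otimes>\<^bsub>A\<^esub> x') (y \<otimes>\<^bsub>B\<^esub> y') = \<beta> x y \<otimes>\<^bsub>C\<^esub> \<beta> x' y'"
  shows "tensor_lift C \<beta> \<in> algebra_hom T C"
proof (rule algebra_homI)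
  note F = tensor_lift_linear
  show "tensor_lift C \<beta> \<one>\<^bsub>T\<^esub> = \<one>\<^bsub>C\<^esub>"
    using tensor_lift_pure[of "\<one>\<^bsub>A\<^esub>" "\<one>\<^bsub>B\<^esub>"] one by (simp add: pure_tensor_one)
  fix t u assume t: "t \<in> carrier T" and u: "u \<in> carrier T"
  from t show "tensor_lift C \<beta> (t \<otimes>\<^bsub>T\<^esub> u) = tensor_lift C \<beta> t \<otimes>\<^bsub>C\<^esub> tensor_lift C \<beta> u"
  proof (induction rule: tensor_induct)
    case (pure x y)
    have "\<beta> x y \<in> carrier C"
      using pure linear_mapsD(1)[OF bilinear_mapsD(1)[OF \<beta>]] by simp
    from u this show ?case
      by (induction rule: tensor_induct)
        (auto simp: pure pure_tensor_mult tensor_lift_pure mult T.r_distr C.r_distr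
          T.smult_mult_right C.smult_mult_right linear_mapsD[OF F])
  qed (auto simp: T.l_distr C.l_distr T.smult_mult_left C.smult_mult_left linear_mapsD[OF F] u)
qed (rule tensor_lift_linear)

end

end

lemma linear_maps_add:
  assumes "complex_algebra B" "f \<in> linear_maps A B" "g \<in> linear_maps A B"
  shows "(\<lambda>x. f x \<oplus>\<^bsub>B\<^esub> g x) \<in> linear_maps A B"
proof -
  interpret B: complex_algebra B by fact
  show ?thesis
    by (rule linear_mapsI)
      (simp_all add: linear_mapsD[OF assms(2)] linear_mapsD[OF assms(3)] B.a_ac B.smult_r_distr)
qed

lemma linear_maps_smult:
  assumes "complex_algebra B" "f \<in> linear_maps A B"
  shows "(\<lambda>x. c \<odot>\<^bsub>B\<^esub> f x) \<in> linear_maps A B"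
  using linear_maps_comp[OF assms(2) complex_algebra.linear_smult[OF assms(1)]] .

lemma bilinear_maps_comp:
  assumes "\<beta> \<in> bilinear_maps A' B' C" "f \<in> linear_maps A A'" "g \<in> linear_maps B B'"
  shows "(\<lambda>x y. \<beta> (f x) (g y)) \<in> bilinear_maps A B C"
  by (intro bilinear_mapsI linear_maps_comp[OF assms(3) bilinear_mapsD(1)[OF assms(1)]]
    linear_maps_comp[OF assms(2) bilinear_mapsD(2)[OF assms(1)]]
    linear_mapsD(1)[OF assms(2)] linear_mapsD(1)[OF assms(3)])

section \<open>Functoriality of the tensor product\<close>

context
  fixes A :: "(complex, 'a) module" and B :: "(complex, 'b) module"
    and A' :: "(complex, 'c) module" and B' :: "(complex, 'd) module"
    and f :: "'a \<Rightarrow> 'c" and g :: "'b \<Rightarrow> 'd"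
  assumes A: "complex_algebra A" and B: "complex_algebra B"
    and A': "complex_algebra A'" and B': "complex_algebra B'"
    and f: "f \<in> linear_maps A A'" and g: "g \<in> linear_maps B B'"
begin

private lemma tensor_map_bilinear:
  "(\<lambda>x y. pure_tensor A' B' (f x) (g y)) \<in> bilinear_maps A B (tensor_algebra A' B')"
  by (rule bilinear_maps_comp[OF pure_tensor_bilinear[OF A' B'] f g])

lemma tensor_map_linear:
  "tensor_map A' B' f g \<in> linear_maps (tensor_algebra A B) (tensor_algebra A' B')"
  unfolding tensor_map_def
  by (rule tensor_lift_linear[OF A B complex_algebra_tensor_algebra[OF A' B'] tensor_map_bilinear])

lemma tensor_map_pure:
  "x \<in> carrier A \<Longrightarrow> y \<in> carrier B \<Longrightarrow>
    tensor_map A' B' f g (pure_tensor A B x y) = pure_tensor A' B' (f x) (g y)"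
  unfolding tensor_map_def
  by (rule tensor_lift_pure[OF A B complex_algebra_tensor_algebra[OF A' B'] tensor_map_bilinear])

lemma tensor_map_algebra_hom:
  assumes "f \<in> algebra_hom A A'" "g \<in> algebra_hom B B'"
  shows "tensor_map A' B' f g \<in> algebra_hom (tensor_algebra A B) (tensor_algebra A' B')"
  unfolding tensor_map_def
  by (rule tensor_lift_algebra_hom[OF A B complex_algebra_tensor_algebra[OF A' B'] tensor_map_bilinear])
    (simp_all add: pure_tensor_one[OF A' B'] pure_tensor_mult[OF A' B']
      algebra_homD[OF assms(1)] algebra_homD[OF assms(2)])

end

section \<open>The associativity isomorphism as an algebra homomorphism\<close>

context
  fixes A :: "(complex, 'a) module" and B :: "(complex, 'b) module" and C :: "(complex, 'c) module"
  assumes A: "complex_algebra A" and B: "complex_algebra B" and C: "complex_algebra C"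
begin

interpretation A: complex_algebra A by (rule A)
interpretation B: complex_algebra B by (rule B)
interpretation C: complex_algebra C by (rule C)
interpretation AB: complex_algebra "tensor_algebra A B"
  by (rule complex_algebra_tensor_algebra[OF A B])
interpretation BC: complex_algebra "tensor_algebra B C"
  by (rule complex_algebra_tensor_algebra[OF B C])
interpretation ABC: complex_algebra "tensor_algebra A (tensor_algebra B C)"
  by (rule complex_algebra_tensor_algebra[OF A BC.complex_algebra])

private abbreviation (input) "AB \<equiv> tensor_algebra A B"
private abbreviation (input) "BC \<equiv> tensor_algebra B C"
private abbreviation (input) "ABC \<equiv> tensor_algebra A BC"
private abbreviation (input) "p x y z \<equiv> pure_tensor A BC x (pure_tensor B C y z)"
private abbreviation (input) "F z \<equiv> tensor_lift ABC (\<lambda>x y. p x y z)"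

private lemma p_bilinear: "z \<in> carrier C \<Longrightarrow> (\<lambda>x y. p x y z) \<in> bilinear_maps A B ABC"
  using bilinear_maps_comp[OF pure_tensor_bilinear[OF A BC.complex_algebra] linear_maps_id
    bilinear_mapsD(2)[OF pure_tensor_bilinear[OF B C]]] by simp

private lemma p_linear:
  "\<lbrakk>x \<in> carrier A; y \<in> carrier B\<rbrakk> \<Longrightarrow> (\<lambda>z. p x y z) \<in> linear_maps C ABC"
  by (rule linear_maps_comp[OF bilinear_mapsD(1)[OF pure_tensor_bilinear[OF B C]]
    bilinear_mapsD(1)[OF pure_tensor_bilinear[OF A BC.complex_algebra]]])

private lemmas F_linear = tensor_lift_linear[OF A B ABC.complex_algebra p_bilinear]
private lemmas F_pure = tensor_lift_pure[OF A B ABC.complex_algebra p_bilinear]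

text \<open>Linearity in t is built into the inner lift, but z enters it only as a parameter. To
  obtain linearity in z, both sides are read as linear maps of t and compared on pure tensors, where
  the map is x \<otimes> (y \<otimes> z).\<close>

private lemma F_bilinear: "(\<lambda>t z. F z t) \<in> bilinear_maps AB C ABC"
proof (intro bilinear_mapsI)
  fix t assume t: "t \<in> carrier AB"
  show "(\<lambda>z. F z t) \<in> linear_maps C ABC"
  proof (rule linear_mapsI)
    fix z assume z: "z \<in> carrier C"
    show "F z t \<in> carrier ABC"
      by (rule linear_mapsD(1)[OF F_linear[OF z] t])
    show "F (c \<odot>\<^bsub>C\<^esub> z) t = c \<odot>\<^bsub>ABC\<^esub> F z t" for c
    proof (rule linear_maps_tensor_eqI[OF A B _ _ _ t])
      show "F (c \<odot>\<^bsub>C\<^esub> z) \<in> linear_maps AB ABC"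
        by (rule F_linear) (simp add: z)
      show "(\<lambda>t. c \<odot>\<^bsub>ABC\<^esub> F z t) \<in> linear_maps AB ABC"
        by (rule linear_maps_smult[OF ABC.complex_algebra F_linear[OF z]])
    qed (simp add: z F_pure linear_mapsD[OF p_linear])
    fix z' assume z': "z' \<in> carrier C"
    show "F (z \<oplus>\<^bsub>C\<^esub> z') t = F z t \<oplus>\<^bsub>ABC\<^esub> F z' t"
    proof (rule linear_maps_tensor_eqI[OF A B _ _ _ t])
      show "F (z \<oplus>\<^bsub>C\<^esub> z') \<in> linear_maps AB ABC"
        by (rule F_linear) (simp add: z z')
      show "(\<lambda>t. F z t \<oplus>\<^bsub>ABC\<^esub> F z' t) \<in> linear_maps AB ABC"
        by (rule linear_maps_add[OF ABC.complex_algebra F_linear[OF z] F_linear[OF z']])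
    qed (simp add: z z' F_pure linear_mapsD[OF p_linear])
  qed
qed (rule F_linear)

text \<open>This is the product condition for the outer lift. It makes \<open>tensor_assoc\<close>
  an algebra homomorphism, without which coassociativity could not be reduced to generators. Both
  sides are linear in t and in u, so pure tensors suffice.\<close>

private lemma F_mult:
  assumes t: "t \<in> carrier AB" and u: "u \<in> carrier AB"
    and z: "z \<in> carrier C" and w: "w \<in> carrier C"
  shows "F (z \<otimes>\<^bsub>C\<^esub> w) (t \<otimes>\<^bsub>AB\<^esub> u) = F z t \<otimes>\<^bsub>ABC\<^esub> F w u"
proof -
  note closed = C.m_closed[OF z w]
  have pure: "F (z \<otimes>\<^bsub>C\<^esub> w) (pure_tensor A B x y \<otimes>\<^bsub>AB\<^esub> u) =
      F z (pure_tensor A B x y) \<otimes>\<^bsub>ABC\<^esub> F w u"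
    if xy: "x \<in> carrier A" "y \<in> carrier B" for x y
  proof (rule linear_maps_tensor_eqI[OF A B _ _ _ u])
    have x: "pure_tensor A B x y \<in> carrier AB" by (rule pure_tensor_closed[OF A B xy])
    show "(\<lambda>u. F (z \<otimes>\<^bsub>C\<^esub> w) (pure_tensor A B x y \<otimes>\<^bsub>AB\<^esub> u)) \<in> linear_maps AB ABC"
      by (rule linear_maps_comp[OF AB.linear_mult_left[OF x] F_linear[OF closed]])
    show "(\<lambda>u. F z (pure_tensor A B x y) \<otimes>\<^bsub>ABC\<^esub> F w u) \<in> linear_maps AB ABC"
      by (rule linear_maps_comp[OF F_linear[OF w] ABC.linear_mult_left])
        (rule linear_mapsD(1)[OF F_linear[OF z] x])
    fix x' y' assume "x' \<in> carrier A" "y' \<in> carrier B"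
    with xy z w show "F (z \<otimes>\<^bsub>C\<^esub> w) (pure_tensor A B x y \<otimes>\<^bsub>AB\<^esub> pure_tensor A B x' y') =
        F z (pure_tensor A B x y) \<otimes>\<^bsub>ABC\<^esub> F w (pure_tensor A B x' y')"
      by (simp add: pure_tensor_mult[OF A B] F_pure pure_tensor_mult[OF A BC.complex_algebra]
        pure_tensor_mult[OF B C] pure_tensor_closed[OF B C])
  qed
  show ?thesis
  proof (rule linear_maps_tensor_eqI[OF A B _ _ _ t])
    show "(\<lambda>t. F (z \<otimes>\<^bsub>C\<^esub> w) (t \<otimes>\<^bsub>AB\<^esub> u)) \<in> linear_maps AB ABC"
      by (rule linear_maps_comp[OF AB.linear_mult_right[OF u] F_linear[OF closed]])
    show "(\<lambda>t. F z t \<otimes>\<^bsub>ABC\<^esub> F w u) \<in> linear_maps AB ABC"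
      by (rule linear_maps_comp[OF F_linear[OF z] ABC.linear_mult_right])
        (rule linear_mapsD(1)[OF F_linear[OF w] u])
  qed (rule pure)
qed

lemma tensor_assoc_pure:
  assumes "x \<in> carrier A" "y \<in> carrier B" "z \<in> carrier C"
  shows "tensor_assoc A B C (pure_tensor AB C (pure_tensor A B x y) z) =
    pure_tensor A BC x (pure_tensor B C y z)"
  using assms unfolding tensor_assoc_def
  by (subst tensor_lift_pure[OF AB.complex_algebra C ABC.complex_algebra F_bilinear])
    (simp_all add: F_pure pure_tensor_closed[OF A B])

lemma tensor_assoc_algebra_hom: "tensor_assoc A B C \<in> algebra_hom (tensor_algebra AB C) ABC"
  unfolding tensor_assoc_def
  by (rule tensor_lift_algebra_hom[OF AB.complex_algebra C ABC.complex_algebra F_bilinear])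
    (simp_all add: pure_tensor_one[OF A B, symmetric] F_pure pure_tensor_one[OF B C]
      pure_tensor_one[OF A BC.complex_algebra] F_mult)

end

section \<open>The unit isomorphisms and the multiplication map\<close>

context complex_algebra
begin

lemma smult_bilinear: "(\<lambda>c x. c \<odot> x) \<in> bilinear_maps complex_alg A A"
  by (intro bilinear_mapsI linear_smult linear_smult_left)

lemma smult_bilinear': "(\<lambda>x c. c \<odot> x) \<in> bilinear_maps A complex_alg A"
  by (intro bilinear_mapsI linear_smult linear_smult_left)

text \<open>Scalars commute with each other and pass through both factors; this is the product
  condition needed to lift scalar multiplication to an algebra homomorphism on \<complex> \<otimes>
  A and on A \<otimes> \<complex>.\<close>

lemma smult_mult_smult:
  "\<lbrakk>x \<in> carrier A; y \<in> carrier A\<rbrakk> \<Longrightarrow> (c * d) \<odot> (x \<otimes> y) = (c \<odot> x) \<otimes> (d \<odot> y)"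
  using smult_assoc1[of d c] by (simp add: smult_mult_left smult_mult_right mult.commute)

lemma tensor_unit_left_algebra_hom:
  "tensor_unit_left A \<in> algebra_hom (tensor_algebra complex_alg A) A"
  unfolding tensor_unit_left_def
  by (rule tensor_lift_algebra_hom[OF complex_algebra_complex_alg complex_algebra complex_algebra
    smult_bilinear]) (simp_all add: smult_mult_smult)

lemma tensor_unit_left_pure:
  "x \<in> carrier A \<Longrightarrow> tensor_unit_left A (pure_tensor complex_alg A c x) = c \<odot> x"
  unfolding tensor_unit_left_def
  by (rule tensor_lift_pure[OF complex_algebra_complex_alg complex_algebra complex_algebra
    smult_bilinear]) simp_all

lemma tensor_unit_right_algebra_hom:
  "tensor_unit_right A \<in> algebra_hom (tensor_algebra A complex_alg) A"
  unfolding tensor_unit_right_def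
  by (rule tensor_lift_algebra_hom[OF complex_algebra complex_algebra_complex_alg complex_algebra
    smult_bilinear']) (simp_all add: smult_mult_smult)

lemma tensor_unit_right_pure:
  "x \<in> carrier A \<Longrightarrow> tensor_unit_right A (pure_tensor A complex_alg x c) = c \<odot> x"
  unfolding tensor_unit_right_def
  by (rule tensor_lift_pure[OF complex_algebra complex_algebra_complex_alg complex_algebra
    smult_bilinear']) simp_all

lemma mult_bilinear: "(\<lambda>x y. x \<otimes> y) \<in> bilinear_maps A A A"
  by (intro bilinear_mapsI linear_mult_left linear_mult_right)

text \<open>In contrast to the unit maps only linearity is claimed: (1 \<otimes> y) (x \<otimes> 1)
  = x \<otimes> y is sent to x y, whereas the product of the images is y x.\<close>

lemma multiplication_map_linear: "multiplication_map A \<in> linear_maps (tensor_algebra A A) A"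
  unfolding multiplication_map_def
  by (rule tensor_lift_linear[OF complex_algebra complex_algebra complex_algebra mult_bilinear])

lemma multiplication_map_pure:
  "\<lbrakk>x \<in> carrier A; y \<in> carrier A\<rbrakk> \<Longrightarrow> multiplication_map A (pure_tensor A A x y) = x \<otimes> y"
  unfolding multiplication_map_def
  by (rule tensor_lift_pure[OF complex_algebra complex_algebra complex_algebra mult_bilinear])

end

section \<open>Antihomomorphisms\<close>

definition opposite_algebra :: "(complex, 'a) module \<Rightarrow> (complex, 'a) module" where
  "opposite_algebra A = A\<lparr>mult := \<lambda>x y. y \<otimes>\<^bsub>A\<^esub> x\<rparr>"

lemma opposite_algebra_simps [simp]:
  "carrier (opposite_algebra A) = carrier A" "one (opposite_algebra A) = one A"
  "zero (opposite_algebra A) = zero A" "add (opposite_algebra A) = add A"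
  "smult (opposite_algebra A) = smult A"
  "x \<otimes>\<^bsub>opposite_algebra A\<^esub> y = y \<otimes>\<^bsub>A\<^esub> x"
  by (simp_all add: opposite_algebra_def)

lemma complex_algebra_opposite_algebra:
  assumes "complex_algebra A"
  shows "complex_algebra (opposite_algebra A)"
proof -
  interpret A: complex_algebra A by fact
  show ?thesis
  proof (rule complex_algebraI)
    show "ring (opposite_algebra A)"
    proof (rule ringI)
      show "abelian_group (opposite_algebra A)"
        by (rule abelian_groupI)
          (auto simp: A.a_ac intro!: A.l_neg bexI[of _ "\<ominus>\<^bsub>A\<^esub> x" for x])
      show "Group.monoid (opposite_algebra A)"
        by (rule monoidI) (auto simp: A.m_assoc)
    qed (auto simp: A.l_distr A.r_distr)
  qed (use A.smult_l_distr A.smult_assoc1 in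
      \<open>auto simp: A.smult_r_distr A.smult_mult_left A.smult_mult_right\<close>)
qed

text \<open>With this reformulation the universal property for homomorphisms also produces
  antihomomorphisms.\<close>

lemma algebra_antihom_iff: "f \<in> algebra_antihom A B \<longleftrightarrow> f \<in> algebra_hom A (opposite_algebra B)"
  by (auto simp: algebra_antihom_def linear_maps_def algebra_hom_def ring_hom_def)

section \<open>Primitively generated Hopf algebras\<close>

context
  fixes H :: "(complex, 'a) module" and G :: "'a set"
    and \<Delta> :: "'a \<Rightarrow> ('a \<times> 'a \<Rightarrow>\<^sub>0 complex) set" and \<epsilon> :: "'a \<Rightarrow> complex" and S :: "'a \<Rightarrow> 'a"
  assumes H: "complex_algebra H" and G: "G \<subseteq> carrier H"
    and generated: "\<And>N. \<lbrakk>N \<subseteq> carrier H; \<one>\<^bsub>H\<^esub> \<in> N; G \<subseteq> N;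
        \<And>x y. \<lbrakk>x \<in> N; y \<in> N\<rbrakk> \<Longrightarrow> x \<otimes>\<^bsub>H\<^esub> y \<in> N;
        \<And>x y. \<lbrakk>x \<in> N; y \<in> N\<rbrakk> \<Longrightarrow> x \<oplus>\<^bsub>H\<^esub> y \<in> N;
        \<And>c x. x \<in> N \<Longrightarrow> c \<odot>\<^bsub>H\<^esub> x \<in> N\<rbrakk> \<Longrightarrow> carrier H \<subseteq> N"
    and \<Delta>: "\<Delta> \<in> algebra_hom H (tensor_algebra H H)"
    and \<Delta>_primitive: "\<And>x. x \<in> G \<Longrightarrow> \<Delta> x =
      pure_tensor H H x \<one>\<^bsub>H\<^esub> \<oplus>\<^bsub>tensor_algebra H H\<^esub> pure_tensor H H \<one>\<^bsub>H\<^esub> x"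
    and \<epsilon>: "\<epsilon> \<in> algebra_hom H complex_alg"
    and \<epsilon>_primitive: "\<And>x. x \<in> G \<Longrightarrow> \<epsilon> x = 0"
    and S: "S \<in> algebra_antihom H H"
    and S_primitive: "\<And>x. x \<in> G \<Longrightarrow> S x = \<ominus>\<^bsub>H\<^esub> x"
begin

interpretation H: complex_algebra H by (rule H)

private abbreviation (input) "HH \<equiv> tensor_algebra H H"

interpretation HH: complex_algebra HH by (rule complex_algebra_tensor_algebra[OF H H])
interpretation HHH: complex_algebra "tensor_algebra H HH"
  by (rule complex_algebra_tensor_algebra[OF H HH.complex_algebra])

text \<open>Generation is assumed as a property of subsets; applied to the elements of H that
  satisfy \<Phi>, it becomes induction. The product case supplies \<Phi> for both factors, as the
  antipode laws require.\<close>

private lemma generated_induct [consumes 1, case_names one gen mult add smult]: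
  assumes "x \<in> carrier H" and "\<Phi> \<one>\<^bsub>H\<^esub>" and "\<And>x. x \<in> G \<Longrightarrow> \<Phi> x"
    and "\<And>x y. \<lbrakk>x \<in> carrier H; y \<in> carrier H; \<Phi> x; \<Phi> y\<rbrakk> \<Longrightarrow> \<Phi> (x \<otimes>\<^bsub>H\<^esub> y)"
    and "\<And>x y. \<lbrakk>x \<in> carrier H; y \<in> carrier H; \<Phi> x; \<Phi> y\<rbrakk> \<Longrightarrow> \<Phi> (x \<oplus>\<^bsub>H\<^esub> y)"
    and "\<And>c x. \<lbrakk>x \<in> carrier H; \<Phi> x\<rbrakk> \<Longrightarrow> \<Phi> (c \<odot>\<^bsub>H\<^esub> x)"
  shows "\<Phi> x"
proof -
  have "carrier H \<subseteq> {x \<in> carrier H. \<Phi> x}"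
    using assms(2-) G by (intro generated) auto
  with assms(1) show ?thesis by auto
qed

private lemma algebra_hom_eqI:
  assumes f: "f \<in> algebra_hom H B" and g: "g \<in> algebra_hom H B"
    and "\<And>x. x \<in> G \<Longrightarrow> f x = g x" and "x \<in> carrier H"
  shows "f x = g x"
  using assms(4)
  by (induction rule: generated_induct) (auto simp: algebra_homD[OF f] algebra_homD[OF g] assms(3))

private lemma gen_closed: "x \<in> G \<Longrightarrow> x \<in> carrier H"
  using G by auto

private lemmas pure_add_left =
  linear_mapsD(2)[OF bilinear_mapsD(2)[OF pure_tensor_bilinear]]
private lemmas pure_add_right =
  linear_mapsD(2)[OF bilinear_mapsD(1)[OF pure_tensor_bilinear]]

private lemma id_linear: "id \<in> linear_maps A A" and id_hom: "id \<in> algebra_hom A A"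
  by (rule linear_maps_id, rule algebra_hom_id)

private lemma S_linear: "S \<in> linear_maps H H"
  using S by (simp add: algebra_antihom_def)

private lemma S_props:
  "x \<in> carrier H \<Longrightarrow> S x \<in> carrier H" "S \<one>\<^bsub>H\<^esub> = \<one>\<^bsub>H\<^esub>"
  "\<lbrakk>x \<in> carrier H; y \<in> carrier H\<rbrakk> \<Longrightarrow> S (x \<otimes>\<^bsub>H\<^esub> y) = S y \<otimes>\<^bsub>H\<^esub> S x"
  using S linear_mapsD(1)[OF S_linear] by (auto simp: algebra_antihom_def)

section \<open>Coassociativity and the counit laws\<close>

private lemma coassoc:
  assumes "x \<in> carrier H"
  shows "tensor_assoc H H H (tensor_map HH H \<Delta> id (\<Delta> x)) = tensor_map H HH id \<Delta> (\<Delta> x)"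
proof (rule algebra_hom_eqI[OF _ _ _ assms])
  note \<Delta>_linear = algebra_homD(1)[OF \<Delta>]
  note map_left = tensor_map_algebra_hom[OF H H HH.complex_algebra H \<Delta>_linear id_linear \<Delta> id_hom]
  note map_right = tensor_map_algebra_hom[OF H H H HH.complex_algebra id_linear \<Delta>_linear id_hom \<Delta>]
  note assoc = tensor_assoc_algebra_hom[OF H H H]
  show "(\<lambda>x. tensor_assoc H H H (tensor_map HH H \<Delta> id (\<Delta> x))) \<in> algebra_hom H (tensor_algebra H HH)"
    by (intro algebra_hom_comp[OF _ assoc] algebra_hom_comp[OF \<Delta> map_left])
  show "(\<lambda>x. tensor_map H HH id \<Delta> (\<Delta> x)) \<in> algebra_hom H (tensor_algebra H HH)"
    by (rule algebra_hom_comp[OF \<Delta> map_right])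
  fix x assume x: "x \<in> G"
  note [simp] = gen_closed[OF x] pure_tensor_closed[OF H H] pure_tensor_closed[OF HH.complex_algebra H]
    pure_tensor_closed[OF H HH.complex_algebra]
  have \<Delta>_one: "\<Delta> \<one>\<^bsub>H\<^esub> = pure_tensor H H \<one>\<^bsub>H\<^esub> \<one>\<^bsub>H\<^esub>"
    by (simp add: algebra_homD(5)[OF \<Delta>] pure_tensor_one[OF H H])
  \<comment> \<open>Before reassociation this is \<Delta>(x) \<otimes> 1 + \<Delta>(1) \<otimes> x,
    a sum of three pure tensors with x in one position and 1 in the other two. The other side, x
    \<otimes> \<Delta>(1) + 1 \<otimes> \<Delta>(x), gives the same three terms, bracketed
    differently.\<close>
  have "tensor_assoc H H H (tensor_map HH H \<Delta> id (\<Delta> x)) =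
    pure_tensor H HH x (pure_tensor H H \<one>\<^bsub>H\<^esub> \<one>\<^bsub>H\<^esub>) \<oplus>\<^bsub>tensor_algebra H HH\<^esub>
    pure_tensor H HH \<one>\<^bsub>H\<^esub> (pure_tensor H H x \<one>\<^bsub>H\<^esub>) \<oplus>\<^bsub>tensor_algebra H HH\<^esub>
    pure_tensor H HH \<one>\<^bsub>H\<^esub> (pure_tensor H H \<one>\<^bsub>H\<^esub> x)"
    by (simp add: \<Delta>_primitive[OF x] algebra_homD(3)[OF map_left] algebra_homD(3)[OF assoc]
      tensor_map_pure[OF H H HH.complex_algebra H \<Delta>_linear id_linear] \<Delta>_one
      pure_add_left[OF HH.complex_algebra H] tensor_assoc_pure[OF H H H]
      complex_algebra_tensor_algebra[OF HH.complex_algebra H, THEN complex_algebra.axioms(2),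
        THEN ring.ring_simprules(1)])
  moreover have "tensor_map H HH id \<Delta> (\<Delta> x) =
    pure_tensor H HH x (pure_tensor H H \<one>\<^bsub>H\<^esub> \<one>\<^bsub>H\<^esub>) \<oplus>\<^bsub>tensor_algebra H HH\<^esub>
    pure_tensor H HH \<one>\<^bsub>H\<^esub> (pure_tensor H H x \<one>\<^bsub>H\<^esub>) \<oplus>\<^bsub>tensor_algebra H HH\<^esub>
    pure_tensor H HH \<one>\<^bsub>H\<^esub> (pure_tensor H H \<one>\<^bsub>H\<^esub> x)"
    by (simp add: \<Delta>_primitive[OF x] algebra_homD(3)[OF map_right]
      tensor_map_pure[OF H H H HH.complex_algebra id_linear \<Delta>_linear] \<Delta>_one
      pure_add_right[OF H HH.complex_algebra] HHH.a_assoc)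
  ultimately show "tensor_assoc H H H (tensor_map HH H \<Delta> id (\<Delta> x)) = tensor_map H HH id \<Delta> (\<Delta> x)"
    by simp
qed

private lemma counit:
  assumes "x \<in> carrier H"
  shows "tensor_unit_left H (tensor_map complex_alg H \<epsilon> id (\<Delta> x)) = x"
    and "tensor_unit_right H (tensor_map H complex_alg id \<epsilon> (\<Delta> x)) = x"
proof -
  note C = complex_algebra_complex_alg
  note \<epsilon>_linear = algebra_homD(1)[OF \<epsilon>]
  note map_left = tensor_map_algebra_hom[OF H H C H \<epsilon>_linear id_linear \<epsilon> id_hom]
  note map_right = tensor_map_algebra_hom[OF H H H C id_linear \<epsilon>_linear id_hom \<epsilon>]
  note \<epsilon>_one = algebra_homD(5)[OF \<epsilon>]
  have "tensor_unit_left H (tensor_map complex_alg H \<epsilon> id (\<Delta> x)) = id x"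
  proof (rule algebra_hom_eqI[OF _ id_hom _ assms])
    show "(\<lambda>x. tensor_unit_left H (tensor_map complex_alg H \<epsilon> id (\<Delta> x))) \<in> algebra_hom H H"
      by (intro algebra_hom_comp[OF _ H.tensor_unit_left_algebra_hom] algebra_hom_comp[OF \<Delta> map_left])
    \<comment> \<open>The value is \<epsilon>(x) 1 + \<epsilon>(1) x = 0 + x.\<close>
    show "tensor_unit_left H (tensor_map complex_alg H \<epsilon> id (\<Delta> x)) = id x" if x: "x \<in> G" for x
      using x by (simp add: \<Delta>_primitive gen_closed pure_tensor_closed[OF H H]
        pure_tensor_closed[OF C H] algebra_homD(3)[OF map_left]
        algebra_homD(3)[OF H.tensor_unit_left_algebra_hom] \<epsilon>_primitive \<epsilon>_one
        tensor_map_pure[OF H H C H \<epsilon>_linear id_linear] H.tensor_unit_left_pure)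
  qed
  then show "tensor_unit_left H (tensor_map complex_alg H \<epsilon> id (\<Delta> x)) = x" by simp
  have "tensor_unit_right H (tensor_map H complex_alg id \<epsilon> (\<Delta> x)) = id x"
  proof (rule algebra_hom_eqI[OF _ id_hom _ assms])
    show "(\<lambda>x. tensor_unit_right H (tensor_map H complex_alg id \<epsilon> (\<Delta> x))) \<in> algebra_hom H H"
      by (intro algebra_hom_comp[OF _ H.tensor_unit_right_algebra_hom] algebra_hom_comp[OF \<Delta> map_right])
    show "tensor_unit_right H (tensor_map H complex_alg id \<epsilon> (\<Delta> x)) = id x" if x: "x \<in> G" for x
      using x by (simp add: \<Delta>_primitive gen_closed pure_tensor_closed[OF H H]
        pure_tensor_closed[OF H C] algebra_homD(3)[OF map_right]
        algebra_homD(3)[OF H.tensor_unit_right_algebra_hom] \<epsilon>_primitive \<epsilon>_one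
        tensor_map_pure[OF H H H C id_linear \<epsilon>_linear] H.tensor_unit_right_pure)
  qed
  then show "tensor_unit_right H (tensor_map H complex_alg id \<epsilon> (\<Delta> x)) = x" by simp
qed

text \<open>Composed with \<Delta>, these two maps are the convolution products of S with id and of
  id with S. They are kept as maps on all of H \<otimes> H because the product rules below are
  proved by varying one tensor over pure tensors, which need not be values of \<Delta>.\<close>

private definition "\<mu>\<^sub>l t = multiplication_map H (tensor_map H H S id t)"
private definition "\<mu>\<^sub>r t = multiplication_map H (tensor_map H H id S t)"

private lemma mu_linear: "\<mu>\<^sub>l \<in> linear_maps HH H" "\<mu>\<^sub>r \<in> linear_maps HH H"
  unfolding \<mu>\<^sub>l_def [abs_def] \<mu>\<^sub>r_def [abs_def]
  by (intro linear_maps_comp[OF _ H.multiplication_map_linear] tensor_map_linear H S_linear id_linear)+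

private lemma mu_pure:
  "\<lbrakk>x \<in> carrier H; y \<in> carrier H\<rbrakk> \<Longrightarrow> \<mu>\<^sub>l (pure_tensor H H x y) = S x \<otimes>\<^bsub>H\<^esub> y"
  "\<lbrakk>x \<in> carrier H; y \<in> carrier H\<rbrakk> \<Longrightarrow> \<mu>\<^sub>r (pure_tensor H H x y) = x \<otimes>\<^bsub>H\<^esub> S y"
  by (simp_all add: \<mu>\<^sub>l_def \<mu>\<^sub>r_def tensor_map_pure[OF H H H H S_linear id_linear]
    tensor_map_pure[OF H H H H id_linear S_linear] H.multiplication_map_pure S_props)

text \<open>For t = x \<otimes> x' both sides are S(y) S(x) x' y': the reversal by S makes S(x) and
  x' neighbours, so that \<open>\<mu>\<^sub>l t\<close> appears as an inner factor.\<close>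

private lemma mu_left_mult_pure:
  assumes t: "t \<in> carrier HH" and y: "y \<in> carrier H" "y' \<in> carrier H"
  shows "\<mu>\<^sub>l (t \<otimes>\<^bsub>HH\<^esub> pure_tensor H H y y') = S y \<otimes>\<^bsub>H\<^esub> (\<mu>\<^sub>l t \<otimes>\<^bsub>H\<^esub> y')"
proof (rule linear_maps_tensor_eqI[OF H H _ _ _ t])
  show "(\<lambda>t. \<mu>\<^sub>l (t \<otimes>\<^bsub>HH\<^esub> pure_tensor H H y y')) \<in> linear_maps HH H"
    by (rule linear_maps_comp[OF HH.linear_mult_right mu_linear(1)])
      (simp add: y pure_tensor_closed[OF H H])
  show "(\<lambda>t. S y \<otimes>\<^bsub>H\<^esub> (\<mu>\<^sub>l t \<otimes>\<^bsub>H\<^esub> y')) \<in> linear_maps HH H"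
    by (rule linear_maps_comp[OF linear_maps_comp[OF mu_linear(1) H.linear_mult_right]
      H.linear_mult_left]) (simp_all add: y S_props)
qed (simp add: y pure_tensor_mult[OF H H] mu_pure S_props H.m_assoc)

text \<open>The mirror image: for u = y \<otimes> y' both sides are x y S(y') S(x'), so here the
  right factor of the product is the one enclosed.\<close>

private lemma mu_right_pure_mult:
  assumes u: "u \<in> carrier HH" and x: "x \<in> carrier H" "x' \<in> carrier H"
  shows "\<mu>\<^sub>r (pure_tensor H H x x' \<otimes>\<^bsub>HH\<^esub> u) = x \<otimes>\<^bsub>H\<^esub> (\<mu>\<^sub>r u \<otimes>\<^bsub>H\<^esub> S x')"
proof (rule linear_maps_tensor_eqI[OF H H _ _ _ u])
  show "(\<lambda>u. \<mu>\<^sub>r (pure_tensor H H x x' \<otimes>\<^bsub>HH\<^esub> u)) \<in> linear_maps HH H"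
    by (rule linear_maps_comp[OF HH.linear_mult_left mu_linear(2)])
      (simp add: x pure_tensor_closed[OF H H])
  show "(\<lambda>u. x \<otimes>\<^bsub>H\<^esub> (\<mu>\<^sub>r u \<otimes>\<^bsub>H\<^esub> S x')) \<in> linear_maps HH H"
    by (rule linear_maps_comp[OF linear_maps_comp[OF mu_linear(2) H.linear_mult_right]
      H.linear_mult_left]) (simp_all add: x S_props)
qed (simp add: x pure_tensor_mult[OF H H] mu_pure S_props H.m_assoc)

text \<open>A scalar in the middle of S(y) (c 1) y' moves out and leaves c times the value at y
  \<otimes> y'. In the companion for \<open>\<mu>\<^sub>r\<close> the scalar hypothesis is on u, the
  factor that is enclosed there.\<close>

private lemma mu_left_mult:
  assumes t: "t \<in> carrier HH" and u: "u \<in> carrier HH" and c: "\<mu>\<^sub>l t = c \<odot>\<^bsub>H\<^esub> \<one>\<^bsub>H\<^esub>"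
  shows "\<mu>\<^sub>l (t \<otimes>\<^bsub>HH\<^esub> u) = c \<odot>\<^bsub>H\<^esub> \<mu>\<^sub>l u"
proof (rule linear_maps_tensor_eqI[OF H H _ _ _ u])
  show "(\<lambda>u. \<mu>\<^sub>l (t \<otimes>\<^bsub>HH\<^esub> u)) \<in> linear_maps HH H"
    by (rule linear_maps_comp[OF HH.linear_mult_left[OF t] mu_linear(1)])
  show "(\<lambda>u. c \<odot>\<^bsub>H\<^esub> \<mu>\<^sub>l u) \<in> linear_maps HH H"
    by (rule linear_maps_smult[OF H mu_linear(1)])
qed (simp add: mu_left_mult_pure[OF t] c mu_pure S_props H.smult_mult_left H.smult_mult_right)

private lemma mu_right_mult:
  assumes t: "t \<in> carrier HH" and u: "u \<in> carrier HH" and c: "\<mu>\<^sub>r u = c \<odot>\<^bsub>H\<^esub> \<one>\<^bsub>H\<^esub>"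
  shows "\<mu>\<^sub>r (t \<otimes>\<^bsub>HH\<^esub> u) = c \<odot>\<^bsub>H\<^esub> \<mu>\<^sub>r t"
proof (rule linear_maps_tensor_eqI[OF H H _ _ _ t])
  show "(\<lambda>t. \<mu>\<^sub>r (t \<otimes>\<^bsub>HH\<^esub> u)) \<in> linear_maps HH H"
    by (rule linear_maps_comp[OF HH.linear_mult_right[OF u] mu_linear(2)])
  show "(\<lambda>t. c \<odot>\<^bsub>H\<^esub> \<mu>\<^sub>r t) \<in> linear_maps HH H"
    by (rule linear_maps_smult[OF H mu_linear(2)])
qed (simp add: mu_right_pure_mult[OF u] c mu_pure S_props H.smult_mult_left H.smult_mult_right)

private lemma antipode:
  assumes "x \<in> carrier H"
  shows "\<mu>\<^sub>l (\<Delta> x) = \<epsilon> x \<odot>\<^bsub>H\<^esub> \<one>\<^bsub>H\<^esub> \<and> \<mu>\<^sub>r (\<Delta> x) = \<epsilon> x \<odot>\<^bsub>H\<^esub> \<one>\<^bsub>H\<^esub>"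
  using assms
proof (induction rule: generated_induct)
  case one
  show ?case
    by (simp add: algebra_homD(5)[OF \<Delta>] pure_tensor_one[OF H H, symmetric] mu_pure S_props
      algebra_homD(5)[OF \<epsilon>])
next
  case (gen x)
  \<comment> \<open>The two maps send x \<otimes> 1 + 1 \<otimes> x to -x + x and to x - x
    respectively, which agrees with \<epsilon>(x) = 0.\<close>
  then show ?case
    by (simp add: \<Delta>_primitive linear_mapsD(2)[OF mu_linear(1)] linear_mapsD(2)[OF mu_linear(2)]
      mu_pure S_props S_primitive \<epsilon>_primitive gen_closed pure_tensor_closed[OF H H]
      H.l_neg H.r_neg)
next
  case (mult x y)
  \<comment> \<open>The left law extracts \<epsilon>(x) first and the right law \<epsilon>(y) first,
    so the scalars arrive in opposite orders; both must match \<epsilon>(x y).\<close>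
  have "\<epsilon> x \<odot>\<^bsub>H\<^esub> (\<epsilon> y \<odot>\<^bsub>H\<^esub> \<one>\<^bsub>H\<^esub>) = (\<epsilon> x * \<epsilon> y) \<odot>\<^bsub>H\<^esub> \<one>\<^bsub>H\<^esub>"
    "\<epsilon> y \<odot>\<^bsub>H\<^esub> (\<epsilon> x \<odot>\<^bsub>H\<^esub> \<one>\<^bsub>H\<^esub>) = (\<epsilon> x * \<epsilon> y) \<odot>\<^bsub>H\<^esub> \<one>\<^bsub>H\<^esub>"
    using H.smult_assoc1[of "\<epsilon> x" "\<epsilon> y"] H.smult_assoc1[of "\<epsilon> y" "\<epsilon> x"] by (simp_all add: mult.commute)
  with mult show ?case
    by (simp add: algebra_homD[OF \<Delta>] algebra_homD[OF \<epsilon>] mu_left_mult mu_right_mult)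
next
  case (add x y)
  then show ?case
    using H.smult_l_distr[of "\<epsilon> x" "\<epsilon> y"]
    by (simp add: algebra_homD[OF \<Delta>] algebra_homD[OF \<epsilon>] linear_mapsD[OF mu_linear(1)]
      linear_mapsD[OF mu_linear(2)])
next
  case (smult c x)
  then show ?case
    using H.smult_assoc1[of c "\<epsilon> x"]
    by (simp add: algebra_homD[OF \<Delta>] algebra_homD[OF \<epsilon>] linear_mapsD[OF mu_linear(1)]
      linear_mapsD[OF mu_linear(2)])
qed

lemma hopf_algebra_primitively_generated: "hopf_algebra H \<Delta> \<epsilon> S"
  by (intro hopf_algebra.intro hopf_algebra_axioms.intro H \<Delta> \<epsilon> S_linear coassoc counit)
    (simp_all add: antipode[unfolded \<mu>\<^sub>l_def \<mu>\<^sub>r_def])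

end

section \<open>Algebras given by generators and relations\<close>

definition word_product :: "('a, 'm) monoid_scheme \<Rightarrow> ('x \<Rightarrow> 'a) \<Rightarrow> 'x list \<Rightarrow> 'a" where
  "word_product B g w = foldr (\<lambda>a z. g a \<otimes>\<^bsub>B\<^esub> z) w \<one>\<^bsub>B\<^esub>"

lemma (in monoid) word_product_closed:
  "(\<And>a. a \<in> X \<Longrightarrow> g a \<in> carrier G) \<Longrightarrow> set w \<subseteq> X \<Longrightarrow> word_product G g w \<in> carrier G"
  by (induction w) (auto simp: word_product_def)

lemma (in monoid) word_product_append:
  assumes "\<And>a. a \<in> X \<Longrightarrow> g a \<in> carrier G" "set v \<subseteq> X" "set w \<subseteq> X"
  shows "word_product G g (v @ w) = word_product G g v \<otimes> word_product G g w"
proof -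
  have closed: "word_product G g u \<in> carrier G" if "set u \<subseteq> X" for u
    using assms(1) that by (rule word_product_closed)
  from assms(2) show ?thesis
  proof (induction v)
    case Nil
    then show ?case
      using closed[OF assms(3)] by (simp add: word_product_def)
  next
    case (Cons a v)
    then show ?case
      using closed[OF assms(3)] closed[of v] assms(1) by (simp add: word_product_def m_assoc)
  qed
qed

text \<open>Since \<open>Idl\<close> is the least ideal containing the relations, a homomorphism
  that kills the relations kills the whole ideal once its kernel is known to be one.\<close>

lemma ideal_kernel:
  assumes A: "complex_algebra A" and B: "complex_algebra B" and f: "f \<in> algebra_hom A B"
  shows "ideal {x \<in> carrier A. f x = \<zero>\<^bsub>B\<^esub>} A"
proof (rule idealI)
  interpret A: complex_algebra A by fact
  interpret B: complex_algebra B by fact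
  show "ring A" ..
  show "subgroup {x \<in> carrier A. f x = \<zero>\<^bsub>B\<^esub>} (add_monoid A)"
    using submodule.axioms(1)[OF submodule_vimage[OF A B algebra_homD(1)[OF f] submodule_zero[OF B]]]
    by simp
qed (use algebra_homD(2,6)[OF f] A B in \<open>auto simp: complex_algebra_def ring.ring_simprules
      semiring.semiring_simprules intro: semiring.l_null semiring.r_null ring.is_monoid\<close>)

section \<open>Free algebras and their quotients by relations\<close>

abbreviation free_monoid :: "'x set \<Rightarrow> 'x list monoid" where
  "free_monoid X \<equiv> \<lparr>carrier = lists X, mult = (@), one = []\<rparr>"

lemma monoid_free_monoid: "monoid (free_monoid X)"
  by (rule monoidI) auto

lemma complex_algebra_free_algebra: "complex_algebra (free_algebra X)"
  unfolding free_algebra_def by (rule complex_algebra_monoid_algebra[OF monoid_free_monoid])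

lemma free_algebra_simps:
  "\<one>\<^bsub>free_algebra X\<^esub> = Poly_Mapping.single [] 1"
  "add (free_algebra X) = (+)"
  "smult (free_algebra X) = (\<lambda>c. Poly_Mapping.map ((*) c))"
  "Poly_Mapping.single v c \<otimes>\<^bsub>free_algebra X\<^esub> Poly_Mapping.single w d =
    Poly_Mapping.single (v @ w) (c * d)"
  by (simp_all add: free_algebra_def monoid_algebra_simps monoid_algebra_mult_single)

lemma single_in_free_algebra:
  assumes "set w \<subseteq> X"
  shows "Poly_Mapping.single w c \<in> carrier (free_algebra X)"
  unfolding free_algebra_def using assms by (intro single_in_monoid_algebra) auto

lemma free_algebra_a_minus:
  "u \<in> carrier (free_algebra X) \<Longrightarrow> t \<ominus>\<^bsub>free_algebra X\<^esub> u = t - u"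
  unfolding free_algebra_def by (rule monoid_algebra_a_minus[OF monoid_free_monoid])

context
  fixes X :: "'x set" and B :: "(complex, 'b) module" and g :: "'x \<Rightarrow> 'b"
  assumes B: "complex_algebra B" and g: "\<And>a. a \<in> X \<Longrightarrow> g a \<in> carrier B"
begin

interpretation B: complex_algebra B by (rule B)

private lemma word_closed: "w \<in> lists X \<Longrightarrow> word_product B g w \<in> carrier B"
  using B.word_product_closed[of X g w] g by auto

lemma free_algebra_lift_hom:
  "linear_extension B (word_product B g) \<in> algebra_hom (free_algebra X) B"
  unfolding free_algebra_def
proof (rule linear_extension_algebra_hom[OF B _ monoid_free_monoid])
  show "word_product B g w \<in> carrier B" if "w \<in> carrier (free_monoid X)" for w
    using that word_closed by simp
  show "word_product B g (v \<otimes>\<^bsub>free_monoid X\<^esub> w) = word_product B g v \<otimes>\<^bsub>B\<^esub> word_product B g w"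
    if "v \<in> carrier (free_monoid X)" "w \<in> carrier (free_monoid X)" for v w
    using that B.word_product_append[of X g v w] g by auto
qed (simp add: word_product_def)

lemma free_algebra_lift_single:
  assumes "set w \<subseteq> X"
  shows "linear_extension B (word_product B g) (Poly_Mapping.single w c) =
    c \<odot>\<^bsub>B\<^esub> word_product B g w"
  using assms word_closed by (intro linear_extension_single[OF B, where G = "free_monoid X"]) auto

text \<open>The universal property of a presentation: the homomorphism from the free algebra
  vanishes on the ideal generated by R and so descends to cosets.\<close>

lemma presented_algebra_lift:
  assumes R: "R \<subseteq> carrier (free_algebra X)"
    and rel: "\<And>t. t \<in> R \<Longrightarrow> linear_extension B (word_product B g) t = \<zero>\<^bsub>B\<^esub>"
  obtains f where
    "f \<in> algebra_hom (quotient_algebra (free_algebra X) (Idl\<^bsub>free_algebra X\<^esub> R)) B"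
    "\<And>a. a \<in> X \<Longrightarrow>
      f ((Idl\<^bsub>free_algebra X\<^esub> R) +>\<^bsub>free_algebra X\<^esub> Poly_Mapping.single [a] 1) = g a"
proof -
  let ?F = "free_algebra X" and ?L = "linear_extension B (word_product B g)"
  interpret F: complex_algebra ?F by (rule complex_algebra_free_algebra)
  have I: "ideal (Idl\<^bsub>?F\<^esub> R) ?F"
    using R by (rule F.genideal_ideal)
  have "Idl\<^bsub>?F\<^esub> R \<subseteq> {t \<in> carrier ?F. ?L t = \<zero>\<^bsub>B\<^esub>}"
    using R rel
    by (intro F.genideal_minimal ideal_kernel[OF F.complex_algebra B free_algebra_lift_hom]) auto
  then have ker: "?L t = \<zero>\<^bsub>B\<^esub>" if "t \<in> Idl\<^bsub>?F\<^esub> R" for t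
    using that by auto
  note L = algebra_homD(1)[OF free_algebra_lift_hom]
  show thesis
  proof (rule that)
    show "(\<lambda>Z. the_elem (?L ` Z)) \<in> algebra_hom (quotient_algebra ?F (Idl\<^bsub>?F\<^esub> R)) B"
      by (rule quotient_lift_algebra_hom[OF F.complex_algebra I B L ker free_algebra_lift_hom])
    show "the_elem (?L ` ((Idl\<^bsub>?F\<^esub> R) +>\<^bsub>?F\<^esub> Poly_Mapping.single [a] 1)) = g a" if "a \<in> X" for a
      using the_elem_image_coset[OF F.complex_algebra I B L ker single_in_free_algebra]
        free_algebra_lift_single[of "[a]" 1] that g[OF that]
      by (simp add: word_product_def)
  qed
qed

end

text \<open>The coset map is a surjective homomorphism, and the free algebra is spanned by words. A
  word is a product of letters, so its class lies in N by induction on its length.\<close>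

lemma presented_algebra_generated:
  fixes X :: "'x set"
  defines "F \<equiv> free_algebra X"
  assumes R: "R \<subseteq> carrier F"
  defines "A \<equiv> quotient_algebra F (Idl\<^bsub>F\<^esub> R)"
  assumes one: "\<one>\<^bsub>A\<^esub> \<in> N" and gen: "\<And>a. a \<in> X \<Longrightarrow> (Idl\<^bsub>F\<^esub> R) +>\<^bsub>F\<^esub> Poly_Mapping.single [a] 1 \<in> N"
    and mult: "\<And>x y. \<lbrakk>x \<in> N; y \<in> N\<rbrakk> \<Longrightarrow> x \<otimes>\<^bsub>A\<^esub> y \<in> N"
    and add: "\<And>x y. \<lbrakk>x \<in> N; y \<in> N\<rbrakk> \<Longrightarrow> x \<oplus>\<^bsub>A\<^esub> y \<in> N"
    and smult: "\<And>c x. x \<in> N \<Longrightarrow> c \<odot>\<^bsub>A\<^esub> x \<in> N"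
  shows "carrier A \<subseteq> N"
proof
  interpret F: complex_algebra F
    unfolding F_def by (rule complex_algebra_free_algebra)
  have I: "ideal (Idl\<^bsub>F\<^esub> R) F"
    using R by (rule F.genideal_ideal)
  interpret A: complex_algebra A
    unfolding A_def by (rule complex_algebra_quotient_algebra[OF F.complex_algebra I])
  let ?q = "\<lambda>t. (Idl\<^bsub>F\<^esub> R) +>\<^bsub>F\<^esub> t"
  have q: "?q \<in> algebra_hom F A"
    unfolding A_def by (rule coset_algebra_hom[OF F.complex_algebra I])
  have single_F: "Poly_Mapping.single w c \<in> carrier F" if "set w \<subseteq> X" for w c
    unfolding F_def using that by (rule single_in_free_algebra)
  note F_simps = free_algebra_simps[of X, folded F_def]
  have word: "?q (Poly_Mapping.single w 1) \<in> N" if "set w \<subseteq> X" for w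
    using that
  proof (induction w)
    case Nil
    show ?case using one algebra_homD(5)[OF q] by (simp add: F_simps)
  next
    case (Cons a w)
    have "?q (Poly_Mapping.single (a # w) 1) =
        ?q (Poly_Mapping.single [a] 1) \<otimes>\<^bsub>A\<^esub> ?q (Poly_Mapping.single w 1)"
      using algebra_homD(6)[OF q, of "Poly_Mapping.single [a] 1" "Poly_Mapping.single w 1"] Cons.prems
      by (simp add: F_simps single_F)
    then show ?case using Cons gen mult by simp
  qed
  have q_single: "?q (Poly_Mapping.single w c) \<in> N" if "set w \<subseteq> X" for w c
    using algebra_homD(4)[OF q single_F[OF that], of c 1] smult[OF word[OF that]]
    by (simp add: F_simps)
  have F_eq: "F = monoid_algebra (free_monoid X)"
    by (simp add: F_def free_algebra_def)
  have "?q t \<in> N" if "t \<in> carrier F" for t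
    using that[unfolded F_eq]
  proof (induction rule: monoid_algebra_induct)
    case zero
    \<comment> \<open>Zero is obtained as 0 times the empty word, whose class is the unit.\<close>
    show ?case using q_single[of "[]" 0] by simp
  next
    case (single w c)
    then show ?case by (intro q_single) auto
  next
    case (add t u)
    then show ?case
      using algebra_homD(3)[OF q, of t u] assms(7) by (simp add: F_simps F_eq[symmetric])
  qed
  then show "x \<in> N" if "x \<in> carrier A" for x
    using that by (auto simp: A_def quotient_algebra_carrier[OF F.complex_algebra I])
qed

section \<open>The Heisenberg algebra\<close>

text \<open>Every prescribed commutator is a multiple of the word \<open>[Eps]\<close>. Its
  coefficient, \<i> or -\<i> for a matching pair and 0 otherwise, lets all relations be treated by
  one formula without distinguishing generators.\<close>

definition bracket_coeff :: "generator \<Rightarrow> generator \<Rightarrow> complex" where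
  "bracket_coeff a b = Poly_Mapping.lookup (heisenberg_bracket a b) [Eps]"

lemma heisenberg_bracket_eq: "heisenberg_bracket a b = Poly_Mapping.single [Eps] (bracket_coeff a b)"
  unfolding bracket_coeff_def by (cases "(a, b)" rule: heisenberg_bracket.cases) auto

lemma heisenberg_relations_subset:
  "heisenberg_relations r s \<subseteq> carrier (free_algebra (heisenberg_generators r s))"
proof -
  have "Eps \<in> heisenberg_generators r s" by (simp add: heisenberg_generators_def)
  then show ?thesis
    by (auto simp: heisenberg_relations_def heisenberg_bracket_eq free_algebra_def
      intro!: monoid_algebra_closed(2) single_in_monoid_algebra)
qed

section \<open>The Heisenberg algebra through its presentation\<close>

context
  fixes r s :: nat
begin

private abbreviation (input) "X \<equiv> heisenberg_generators r s"
private abbreviation (input) "H \<equiv> heisenberg_algebra r s"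
private abbreviation (input) "gen \<equiv> heisenberg_gen r s"
private abbreviation (input) "FX \<equiv> free_algebra X"

interpretation FX: complex_algebra FX by (rule complex_algebra_free_algebra)

private lemma heisenberg_ideal_ideal: "ideal (heisenberg_ideal r s) FX"
  unfolding heisenberg_ideal_def by (rule FX.genideal_ideal[OF heisenberg_relations_subset])

lemma complex_algebra_heisenberg_algebra: "complex_algebra H"
  unfolding heisenberg_algebra_def by (rule complex_algebra_quotient_algebra[OF FX.complex_algebra heisenberg_ideal_ideal])

interpretation H: complex_algebra H by (rule complex_algebra_heisenberg_algebra)

private lemma heisenberg_coset_hom: "(\<lambda>t. heisenberg_ideal r s +>\<^bsub>FX\<^esub> t) \<in> algebra_hom FX H"
  unfolding heisenberg_algebra_def by (rule coset_algebra_hom[OF FX.complex_algebra heisenberg_ideal_ideal])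

lemma Eps_in_heisenberg_generators [simp]: "Eps \<in> X"
  by (simp add: heisenberg_generators_def)

lemma heisenberg_gen_closed [simp]: "a \<in> X \<Longrightarrow> gen a \<in> carrier H"
  unfolding heisenberg_gen_def
  by (rule algebra_homD(2)[OF heisenberg_coset_hom]) (simp add: single_in_free_algebra)

lemma heisenberg_commutation:
  assumes a: "a \<in> X" and b: "b \<in> X"
  shows "gen a \<otimes>\<^bsub>H\<^esub> gen b = gen b \<otimes>\<^bsub>H\<^esub> gen a \<oplus>\<^bsub>H\<^esub> bracket_coeff a b \<odot>\<^bsub>H\<^esub> gen Eps"
proof -
  let ?q = "\<lambda>t. heisenberg_ideal r s +>\<^bsub>FX\<^esub> t"
  let ?t = "Poly_Mapping.single [a, b] 1" and ?u = "Poly_Mapping.single [b, a] 1"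
    and ?v = "Poly_Mapping.single [Eps] (bracket_coeff a b)"
  have closed: "?t \<in> carrier FX" "?u \<in> carrier FX" "?v \<in> carrier FX"
    using a b by (simp_all add: single_in_free_algebra)
  have "?t - ?u - ?v \<in> heisenberg_ideal r s"
    using a b FX.genideal_self[OF heisenberg_relations_subset]
    by (auto simp: heisenberg_ideal_def heisenberg_relations_def heisenberg_bracket_eq)
  \<comment> \<open>Regrouping the relation as one difference makes it the criterion for equality of
    two cosets, so the commutation rule comes out with a sum on the right and no
    subtraction.\<close>
  then have "?t \<ominus>\<^bsub>FX\<^esub> (?u \<oplus>\<^bsub>FX\<^esub> ?v) \<in> heisenberg_ideal r s"
    using closed FX.add.m_closed[OF closed(2,3)]
    by (simp add: free_algebra_a_minus free_algebra_simps diff_diff_eq)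
  then have "?q ?t = ?q (?u \<oplus>\<^bsub>FX\<^esub> ?v)"
    using closed FX.quotient_eq_iff_same_a_r_cos[OF heisenberg_ideal_ideal] by simp
  also have "\<dots> = ?q ?u \<oplus>\<^bsub>H\<^esub> ?q ?v"
    using closed by (intro algebra_homD(3)[OF heisenberg_coset_hom])
  also have "?q ?v = bracket_coeff a b \<odot>\<^bsub>H\<^esub> gen Eps"
    using algebra_homD(4)[OF heisenberg_coset_hom, of "Poly_Mapping.single [Eps] 1" "bracket_coeff a b"]
    by (simp add: single_in_free_algebra free_algebra_simps heisenberg_gen_def)
  finally show ?thesis
    using a b algebra_homD(6)[OF heisenberg_coset_hom, of "Poly_Mapping.single [a] 1" "Poly_Mapping.single [b] 1"]
      algebra_homD(6)[OF heisenberg_coset_hom, of "Poly_Mapping.single [b] 1" "Poly_Mapping.single [a] 1"]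
    by (simp add: single_in_free_algebra free_algebra_simps heisenberg_gen_def)
qed

text \<open>The homomorphism from the free algebra sends each relation to the difference of the two
  sides of \<open>comm\<close>. When a or b is \<open>Eps\<close> the coefficient is 0, so
  \<open>comm\<close> includes the requirement that g Eps commute with all the chosen
  images.\<close>

lemma heisenberg_lift:
  fixes g :: "generator \<Rightarrow> 'b"
  assumes B: "complex_algebra B" and g: "\<And>a. a \<in> X \<Longrightarrow> g a \<in> carrier B"
    and comm: "\<And>a b. \<lbrakk>a \<in> X; b \<in> X\<rbrakk> \<Longrightarrow>
      g a \<otimes>\<^bsub>B\<^esub> g b = g b \<otimes>\<^bsub>B\<^esub> g a \<oplus>\<^bsub>B\<^esub> bracket_coeff a b \<odot>\<^bsub>B\<^esub> g Eps"
  obtains f where "f \<in> algebra_hom H B" "\<And>a. a \<in> X \<Longrightarrow> f (gen a) = g a"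
proof -
  interpret B: complex_algebra B by fact
  let ?L = "linear_extension B (word_product B g)"
  have minus: "?L (t - u) = ?L t \<ominus>\<^bsub>B\<^esub> ?L u" if "t \<in> carrier FX" "u \<in> carrier FX" for t u
  proof -
    have "t - u = t \<ominus>\<^bsub>FX\<^esub> u"
      using that by (simp add: free_algebra_a_minus)
    then show ?thesis
      using linear_map_minus[OF FX.complex_algebra B algebra_homD(1)[OF free_algebra_lift_hom[OF B g]]] that
      by simp
  qed
  have rel: "?L t = \<zero>\<^bsub>B\<^esub>" if t: "t \<in> heisenberg_relations r s" for t
  proof -
    obtain a b where ab: "a \<in> X" "b \<in> X"
      and t_eq: "t = Poly_Mapping.single [a, b] 1 - Poly_Mapping.single [b, a] 1
        - Poly_Mapping.single [Eps] (bracket_coeff a b)"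
      using t by (auto simp: heisenberg_relations_def heisenberg_bracket_eq)
    have "Poly_Mapping.single [a, b] 1 - Poly_Mapping.single [b, a] 1 \<in> carrier FX"
      using ab by (auto simp: free_algebra_def intro!: monoid_algebra_closed(2) single_in_monoid_algebra)
    then have "?L t = g a \<otimes>\<^bsub>B\<^esub> g b \<ominus>\<^bsub>B\<^esub> g b \<otimes>\<^bsub>B\<^esub> g a \<ominus>\<^bsub>B\<^esub> bracket_coeff a b \<odot>\<^bsub>B\<^esub> g Eps"
      using ab g by (simp add: t_eq minus single_in_free_algebra free_algebra_lift_single[OF B g]
        word_product_def)
    also have "\<dots> = \<zero>\<^bsub>B\<^esub>"
      using g[OF ab(1)] g[OF ab(2)] g[of Eps]
      by (subst comm[OF ab]) (simp add: B.add_minus_cancel)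
    finally show ?thesis .
  qed
  from presented_algebra_lift[OF B g heisenberg_relations_subset rel] that show thesis
    unfolding heisenberg_algebra_def heisenberg_gen_def heisenberg_ideal_def by blast
qed

lemma heisenberg_generated:
  assumes "\<one>\<^bsub>H\<^esub> \<in> N" "gen ` X \<subseteq> N"
    "\<And>x y. \<lbrakk>x \<in> N; y \<in> N\<rbrakk> \<Longrightarrow> x \<otimes>\<^bsub>H\<^esub> y \<in> N"
    "\<And>x y. \<lbrakk>x \<in> N; y \<in> N\<rbrakk> \<Longrightarrow> x \<oplus>\<^bsub>H\<^esub> y \<in> N"
    "\<And>c x. x \<in> N \<Longrightarrow> c \<odot>\<^bsub>H\<^esub> x \<in> N"
  shows "carrier H \<subseteq> N"
  using assms
  unfolding heisenberg_algebra_def heisenberg_gen_def heisenberg_ideal_def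
  by (intro presented_algebra_generated[OF heisenberg_relations_subset]) auto

section \<open>The coproduct, the counit and the antipode\<close>

private abbreviation (input) "TH \<equiv> tensor_algebra H H"
private abbreviation (input) "tens \<equiv> pure_tensor H H"

lemma heisenberg_coproduct:
  obtains \<Delta> where "\<Delta> \<in> algebra_hom H TH"
    "\<And>a. a \<in> X \<Longrightarrow> \<Delta> (gen a) = tens (gen a) \<one>\<^bsub>H\<^esub> \<oplus>\<^bsub>TH\<^esub> tens \<one>\<^bsub>H\<^esub> (gen a)"
proof (rule heisenberg_lift)
  note H = complex_algebra_heisenberg_algebra
  interpret TH: complex_algebra TH by (rule complex_algebra_tensor_algebra[OF H H])
  note [simp] = pure_tensor_closed[OF H H]
  note bilinear = linear_mapsD(2,3)[OF bilinear_mapsD(2)[OF pure_tensor_bilinear[OF H H]]]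
    linear_mapsD(2,3)[OF bilinear_mapsD(1)[OF pure_tensor_bilinear[OF H H]]]
  show "complex_algebra TH" ..
  show "tens (gen a) \<one>\<^bsub>H\<^esub> \<oplus>\<^bsub>TH\<^esub> tens \<one>\<^bsub>H\<^esub> (gen a) \<in> carrier TH" if "a \<in> X" for a
    using that by simp
  fix a b assume a: "a \<in> X" and b: "b \<in> X"
  let ?c = "bracket_coeff a b"
  \<comment> \<open>Stated for arbitrary a and b because it is used in both orders. Exchanging them
    affects only the unmixed part, where the commutation rule of H and bilinearity add c times (Eps
    \<otimes> 1 + 1 \<otimes> Eps), which is c times the intended image of Eps.\<close>
  have expand: "(tens (gen a) \<one>\<^bsub>H\<^esub> \<oplus>\<^bsub>TH\<^esub> tens \<one>\<^bsub>H\<^esub> (gen a)) \<otimes>\<^bsub>TH\<^esub>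
      (tens (gen b) \<one>\<^bsub>H\<^esub> \<oplus>\<^bsub>TH\<^esub> tens \<one>\<^bsub>H\<^esub> (gen b)) =
    (tens (gen a \<otimes>\<^bsub>H\<^esub> gen b) \<one>\<^bsub>H\<^esub> \<oplus>\<^bsub>TH\<^esub> tens \<one>\<^bsub>H\<^esub> (gen a \<otimes>\<^bsub>H\<^esub> gen b)) \<oplus>\<^bsub>TH\<^esub>
    (tens (gen a) (gen b) \<oplus>\<^bsub>TH\<^esub> tens (gen b) (gen a))" if "a \<in> X" "b \<in> X" for a b
    using that by (simp add: TH.l_distr TH.r_distr pure_tensor_mult[OF H H] TH.a_ac)
  show "(tens (gen a) \<one>\<^bsub>H\<^esub> \<oplus>\<^bsub>TH\<^esub> tens \<one>\<^bsub>H\<^esub> (gen a)) \<otimes>\<^bsub>TH\<^esub>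
      (tens (gen b) \<one>\<^bsub>H\<^esub> \<oplus>\<^bsub>TH\<^esub> tens \<one>\<^bsub>H\<^esub> (gen b)) =
    (tens (gen b) \<one>\<^bsub>H\<^esub> \<oplus>\<^bsub>TH\<^esub> tens \<one>\<^bsub>H\<^esub> (gen b)) \<otimes>\<^bsub>TH\<^esub>
      (tens (gen a) \<one>\<^bsub>H\<^esub> \<oplus>\<^bsub>TH\<^esub> tens \<one>\<^bsub>H\<^esub> (gen a)) \<oplus>\<^bsub>TH\<^esub>
    ?c \<odot>\<^bsub>TH\<^esub> (tens (gen Eps) \<one>\<^bsub>H\<^esub> \<oplus>\<^bsub>TH\<^esub> tens \<one>\<^bsub>H\<^esub> (gen Eps))"
    using a b
    by (simp add: expand heisenberg_commutation[OF a b] bilinear TH.smult_r_distr TH.a_ac)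
qed blast

lemma heisenberg_counit:
  obtains \<epsilon> where "\<epsilon> \<in> algebra_hom H complex_alg" "\<And>a. a \<in> X \<Longrightarrow> \<epsilon> (gen a) = 0"
  by (rule heisenberg_lift[OF complex_algebra_complex_alg, of "\<lambda>_. 0"]) auto

lemma heisenberg_antipode:
  obtains S where "S \<in> algebra_antihom H H" "\<And>a. a \<in> X \<Longrightarrow> S (gen a) = \<ominus>\<^bsub>H\<^esub> gen a"
proof (rule heisenberg_lift)
  note H = complex_algebra_heisenberg_algebra
  show "complex_algebra (opposite_algebra H)"
    by (rule complex_algebra_opposite_algebra[OF H])
  show "\<ominus>\<^bsub>H\<^esub> gen a \<in> carrier (opposite_algebra H)" if "a \<in> X" for a
    using that by simp
  fix a b assume a: "a \<in> X" and b: "b \<in> X"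
  \<comment> \<open>In H this reads b a = a b - c Eps: the two signs in each product cancel, and the
    sign of the image of Eps compensates for the reversed order.\<close>
  then show "(\<ominus>\<^bsub>H\<^esub> gen a) \<otimes>\<^bsub>opposite_algebra H\<^esub> (\<ominus>\<^bsub>H\<^esub> gen b) =
    (\<ominus>\<^bsub>H\<^esub> gen b) \<otimes>\<^bsub>opposite_algebra H\<^esub> (\<ominus>\<^bsub>H\<^esub> gen a) \<oplus>\<^bsub>opposite_algebra H\<^esub>
    bracket_coeff a b \<odot>\<^bsub>opposite_algebra H\<^esub> (\<ominus>\<^bsub>H\<^esub> gen Eps)"
    using H.smult_r_minus[of "bracket_coeff a b" "gen Eps"]
    by (simp add: H.l_minus H.r_minus heisenberg_commutation[OF a b] H.a_assoc H.r_neg)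
qed (simp_all add: algebra_antihom_iff)

end

theorem theorem17:
  fixes r s :: nat
  assumes "r \<ge> 1"
  defines "H \<equiv> heisenberg_algebra r s"
    and "gen \<equiv> heisenberg_gen r s"
  defines "tens \<equiv> pure_tensor H H"
  shows "\<exists>\<Delta> \<epsilon> S.
    \<Delta> \<in> algebra_hom H (tensor_algebra H H) \<and>
    \<epsilon> \<in> algebra_hom H complex_alg \<and>
    S \<in> algebra_antihom H H \<and>
    \<Delta> \<one>\<^bsub>H\<^esub> = tens \<one>\<^bsub>H\<^esub> \<one>\<^bsub>H\<^esub> \<and>
    \<Delta> (gen Eps) = tens (gen Eps) \<one>\<^bsub>H\<^esub> \<oplus>\<^bsub>tensor_algebra H H\<^esub> tens \<one>\<^bsub>H\<^esub> (gen Eps) \<and>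
    (\<forall>x\<in>heisenberg_variables r s.
      \<Delta> (gen x) = tens (gen x) \<one>\<^bsub>H\<^esub> \<oplus>\<^bsub>tensor_algebra H H\<^esub> tens \<one>\<^bsub>H\<^esub> (gen x)) \<and>
    \<epsilon> \<one>\<^bsub>H\<^esub> = 1 \<and> \<epsilon> (gen Eps) = 0 \<and> (\<forall>x\<in>heisenberg_variables r s. \<epsilon> (gen x) = 0) \<and>
    S \<one>\<^bsub>H\<^esub> = \<one>\<^bsub>H\<^esub> \<and> S (gen Eps) = \<ominus>\<^bsub>H\<^esub> gen Eps \<and>
    (\<forall>x\<in>heisenberg_variables r s. S (gen x) = \<ominus>\<^bsub>H\<^esub> gen x) \<and>
    hopf_algebra H \<Delta> \<epsilon> S"
proof -
  let ?X = "heisenberg_generators r s"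
  have H: "complex_algebra H"
    unfolding H_def by (rule complex_algebra_heisenberg_algebra)
  obtain \<Delta> where \<Delta>: "\<Delta> \<in> algebra_hom H (tensor_algebra H H)"
    "\<And>a. a \<in> ?X \<Longrightarrow> \<Delta> (gen a) = tens (gen a) \<one>\<^bsub>H\<^esub> \<oplus>\<^bsub>tensor_algebra H H\<^esub> tens \<one>\<^bsub>H\<^esub> (gen a)"
    unfolding H_def gen_def tens_def by (rule heisenberg_coproduct) blast
  obtain \<epsilon> where \<epsilon>: "\<epsilon> \<in> algebra_hom H complex_alg" "\<And>a. a \<in> ?X \<Longrightarrow> \<epsilon> (gen a) = 0"
    unfolding H_def gen_def by (rule heisenberg_counit) blast
  obtain S where S: "S \<in> algebra_antihom H H" "\<And>a. a \<in> ?X \<Longrightarrow> S (gen a) = \<ominus>\<^bsub>H\<^esub> gen a"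
    unfolding H_def gen_def by (rule heisenberg_antipode) blast
  have "hopf_algebra H \<Delta> \<epsilon> S"
  \<comment> \<open>The central generator belongs to G as well: it is primitive like the others, so
    all generators are treated alike.\<close>
  proof (rule hopf_algebra_primitively_generated[OF H, where G = "gen ` ?X"])
    show "gen ` ?X \<subseteq> carrier H"
      by (auto simp: H_def gen_def)
    show "carrier H \<subseteq> N" if "\<one>\<^bsub>H\<^esub> \<in> N" "gen ` ?X \<subseteq> N"
      "\<And>x y. \<lbrakk>x \<in> N; y \<in> N\<rbrakk> \<Longrightarrow> x \<otimes>\<^bsub>H\<^esub> y \<in> N" "\<And>x y. \<lbrakk>x \<in> N; y \<in> N\<rbrakk> \<Longrightarrow> x \<oplus>\<^bsub>H\<^esub> y \<in> N"
      "\<And>c x. x \<in> N \<Longrightarrow> c \<odot>\<^bsub>H\<^esub> x \<in> N" for N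
      using that unfolding H_def gen_def by (rule heisenberg_generated)
  qed (use \<Delta> \<epsilon> S in \<open>auto simp: tens_def\<close>)
  moreover have "\<Delta> \<one>\<^bsub>H\<^esub> = tens \<one>\<^bsub>H\<^esub> \<one>\<^bsub>H\<^esub>" "\<epsilon> \<one>\<^bsub>H\<^esub> = 1" "S \<one>\<^bsub>H\<^esub> = \<one>\<^bsub>H\<^esub>"
    using algebra_homD(5)[OF \<Delta>(1)] algebra_homD(5)[OF \<epsilon>(1)] S(1) pure_tensor_one[OF H H]
    by (auto simp: tens_def algebra_antihom_def)
  moreover have "Eps \<in> ?X" "heisenberg_variables r s \<subseteq> ?X"
    by (auto simp: heisenberg_generators_def)
  ultimately show ?thesis
    using \<Delta> \<epsilon> S by (intro exI[of _ \<Delta>] exI[of _ \<epsilon>] exI[of _ S]) auto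
qed

end
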